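(* Let $n\ge 1$, $b \geq 1$ be integers, let $f:\{0,1\}^n \rightarrow \{0,1\}$ be a total Boolean function that depends on all its inputs (i.e., it is not a junta on a strict subset of its inputs), and let $\epsilon \in (0, 1/2)$. Let $\mathsf{IP} : \{0, 1\}^b \times \{0, 1\}^b \to \{0, 1\}$ be the Inner Product function. Then $\mathsf{Q}^{\rightarrow,\epsilon}_{\mathrm{cc}}(f \circ \mathsf{IP}) \geq (1-\mathbb{H}_\mathsf{bin}(\epsilon))\,n(b-1)$ and $\mathsf{Q}^{*,\rightarrow,\epsilon}_{\mathrm{cc}}(f \circ \mathsf{IP}) \geq (1-\mathbb{H}_\mathsf{bin}(\epsilon))\,n(b-1)/2$.
   Context: $\mathsf{IP}(x_1,\dots,x_b,y_1,\dots,y_b)=\oplus_{i\in[b]}(x_i\wedge y_i)$. The composed function $f\circ\mathsf{IP}$ is the two-party function in which Alice holds $x=(x_1,\dots,x_n)$ and Bob holds $y=(y_1,\dots,y_n)$ with $x_i,y_i\in\{0,1\}^b$, and $(f\circ\mathsf{IP})(x,y)=f(\mathsf{IP}(x_1,y_1),\dots,\mathsf{IP}(x_n,y_n))$. $\mathsf{Q}^{\rightarrow,\epsilon}_{\mathrm{cc}}(F)$ is the minimum cost (number of qubits of Alice's message) of a one-way quantum protocol (Alice sends a quantum message to Bob, who performs a projective measurement and outputs its outcome) that outputs $F(x,y)$ with probability at least $1-\epsilon$ on every input; $\mathsf{Q}^{*,\rightarrow,\epsilon}_{\mathrm{cc}}(F)$ is the same when Alice and Bob may additionally share an arbitrary input-independent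 entangled state for free. $\mathbb{H}_\mathsf{bin}(p)=p\log\frac1p+(1-p)\log\frac1{1-p}$ is the binary entropy; logarithms are base 2. *)

theory Defs
  imports Complex_Main "Jordan_Normal_Form.Matrix" "Jordan_Normal_Form.Schur_Decomposition"
begin

definition IP :: "bool list \<Rightarrow> bool list \<Rightarrow> bool" where
  "IP u v = odd (length (filter id (map2 (\<and>) u v)))"

definition block_inputs :: "nat \<Rightarrow> nat \<Rightarrow> bool list list set" where
  "block_inputs n b = {xs. length xs = n \<and> (\<forall>v\<in>set xs. length v = b)}"

definition compose_IP :: "(bool list \<Rightarrow> bool) \<Rightarrow> bool list list \<Rightarrow> bool list list \<Rightarrow> bool" where
  "compose_IP f x y = f (map2 IP x y)"

definition depends_on_all :: "nat \<Rightarrow> (bool list \<Rightarrow> bool) \<Rightarrow> bool" where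
  "depends_on_all n f \<longleftrightarrow>
     (\<forall>i<n. \<exists>x. length x = n \<and> f x \<noteq> f (x[i := \<not> x ! i]))"

definition Hbin :: "real \<Rightarrow> real" where
  "Hbin p = p * log 2 (1 / p) + (1 - p) * log 2 (1 / (1 - p))"

definition mtrace :: "complex mat \<Rightarrow> complex" where
  "mtrace A = (\<Sum>i<dim_row A. A $$ (i, i))"

definition kron :: "complex mat \<Rightarrow> complex mat \<Rightarrow> complex mat" where
  "kron A B = mat (dim_row A * dim_row B) (dim_col A * dim_col B)
     (\<lambda>(i, j). A $$ (i div dim_row B, j div dim_col B) * B $$ (i mod dim_row B, j mod dim_col B))"

definition psd :: "nat \<Rightarrow> complex mat \<Rightarrow> bool" where
  "psd d A \<longleftrightarrow> A \<in> carrier_mat d d \<and>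
     (\<forall>v \<in> carrier_vec d. Im (conjugate v \<bullet> (A *\<^sub>v v)) = 0 \<and> Re (conjugate v \<bullet> (A *\<^sub>v v)) \<ge> 0)"

definition density :: "nat \<Rightarrow> complex mat \<Rightarrow> bool" where
  "density d \<rho> \<longleftrightarrow> psd d \<rho> \<and> mtrace \<rho> = 1"

text \<open>Orthogonal projector on C^d; the two-outcome projective measurement
  with projector P has outcome 1 for P and outcome 0 for 1 - P.\<close>
definition projector :: "nat \<Rightarrow> complex mat \<Rightarrow> bool" where
  "projector d P \<longleftrightarrow> P \<in> carrier_mat d d \<and> P * P = P \<and> mat_adjoint P = P"

definition prob_outcome :: "nat \<Rightarrow> complex mat \<Rightarrow> complex mat \<Rightarrow> bool \<Rightarrow> real" where
  "prob_outcome d P \<rho> c = Re (mtrace ((if c then P else 1\<^sub>m d - P) * \<rho>))"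

definition kraus :: "nat \<Rightarrow> nat \<Rightarrow> complex mat list \<Rightarrow> bool" where
  "kraus dM dA Ks \<longleftrightarrow> (\<forall>K\<in>set Ks. K \<in> carrier_mat dM dA) \<and>
     foldr (\<lambda>K S. mat_adjoint K * K + S) Ks (0\<^sub>m dA dA) = 1\<^sub>m dA"

definition apply_first :: "nat \<Rightarrow> nat \<Rightarrow> complex mat list \<Rightarrow> complex mat \<Rightarrow> complex mat" where
  "apply_first dM dB Ks \<psi> =
     foldr (\<lambda>K S. kron K (1\<^sub>m dB) * \<psi> * mat_adjoint (kron K (1\<^sub>m dB)) + S) Ks (0\<^sub>m (dM * dB) (dM * dB))"

text \<open>One-way protocol of cost q without shared entanglement: Alice sends a
  q-qubit state rho_x; Bob measures it with a projective measurement depending on y.\<close>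
definition oneway_protocol ::
  "'a set \<Rightarrow> 'b set \<Rightarrow> ('a \<Rightarrow> 'b \<Rightarrow> bool) \<Rightarrow> real \<Rightarrow> nat \<Rightarrow> bool" where
  "oneway_protocol X Y F \<epsilon> q \<longleftrightarrow>
     (\<exists>\<rho> P. (\<forall>x\<in>X. density (2^q) (\<rho> x)) \<and> (\<forall>y\<in>Y. projector (2^q) (P y)) \<and>
       (\<forall>x\<in>X. \<forall>y\<in>Y. prob_outcome (2^q) (P y) (\<rho> x) (F x y) \<ge> 1 - \<epsilon>))"

text \<open>One-way protocol of cost q with an arbitrary shared state psi on C^dA (x) C^dB
  (A Alice's part, B Bob's part): Alice applies a channel (depending on x) from her
  register to a q-qubit message register M, sends M, and Bob performs a projective
  measurement (depending on y) on M (x) B.\<close>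
definition oneway_protocol_ent ::
  "'a set \<Rightarrow> 'b set \<Rightarrow> ('a \<Rightarrow> 'b \<Rightarrow> bool) \<Rightarrow> real \<Rightarrow> nat \<Rightarrow> bool" where
  "oneway_protocol_ent X Y F \<epsilon> q \<longleftrightarrow>
     (\<exists>dA dB \<psi> K P. dA > 0 \<and> dB > 0 \<and> density (dA * dB) \<psi> \<and>
       (\<forall>x\<in>X. kraus (2^q) dA (K x)) \<and> (\<forall>y\<in>Y. projector (2^q * dB) (P y)) \<and>
       (\<forall>x\<in>X. \<forall>y\<in>Y.
          prob_outcome (2^q * dB) (P y) (apply_first (2^q) dB (K x) \<psi>) (F x y) \<ge> 1 - \<epsilon>))"

definition Q_oneway :: "'a set \<Rightarrow> 'b set \<Rightarrow> ('a \<Rightarrow> 'b \<Rightarrow> bool) \<Rightarrow> real \<Rightarrow> nat" where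
  "Q_oneway X Y F \<epsilon> = (LEAST q. oneway_protocol X Y F \<epsilon> q)"

definition Q_oneway_ent :: "'a set \<Rightarrow> 'b set \<Rightarrow> ('a \<Rightarrow> 'b \<Rightarrow> bool) \<Rightarrow> real \<Rightarrow> nat" where
  "Q_oneway_ent X Y F \<epsilon> = (LEAST q. oneway_protocol_ent X Y F \<epsilon> q)"

end

theory Submission
  imports Defs "HOL-Analysis.L2_Norm"
begin

text \<open>Since \<open>f\<close> depends on every input, Bob can fix all blocks but the \<open>i\<close>-th so that \<open>f \<circ> IP\<close> reveals any
  chosen bit of the last \<open>b - 1\<close> bits of Alice's \<open>i\<close>-th block, the first bit of every block being 1. A protocol
  for \<open>f \<circ> IP\<close> is therefore a quantum random access code for \<open>N = n(b - 1)\<close> bits, and it remains to prove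
  Nayak's bound. No entropy is used. If all code states satisfy \<open>\<rho>\<^sub>z \<le> \<lambda> \<tau>\<close> for one density matrix \<open>\<tau>\<close>,
  then the \<open>k\<close>-th tensor powers satisfy this with \<open>\<lambda>\<^sup>k\<close>, so a measurement identifies a uniformly random tuple of
  \<open>k\<close> code words with probability at most \<open>\<lambda>\<^sup>k / 2\<^bsup>kN\<^esup>\<close>. On the other hand, project for each of the
  \<open>N\<close> positions in turn onto the outcomes within Hamming distance \<open>rk\<close>, \<open>r > \<epsilon>\<close>, of a guess of its \<open>k\<close> bits. The
  correct guess passes with probability close to 1 by the Chernoff bound, almost without disturbing
  the state, and the projectors for all guesses sum up to \<open>V\<close> times the identity, where \<open>V \<le> 2\<^bsup>kH(r)\<^esup>\<close> is
  the volume of a Hamming ball. So the probability of identification is about \<open>V\<^bsup>-N\<^esup>\<close>, and \<open>k \<rightarrow> \<infinity>\<close>, \<open>r \<rightarrow> \<epsilon>\<close> give \<open>N(1 - H(\<epsilon>)) \<le> log \<lambda>\<close>.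
  Here \<open>\<lambda> = 2\<^sup>q\<close> without shared entanglement and \<open>\<lambda> = 4\<^sup>q\<close> with it.\<close>

section \<open>Matrices, adjoints and traces\<close>

lemma mat_adjoint_eq: "mat_adjoint (A :: complex mat) = mat (dim_col A) (dim_row A) (\<lambda>(i, j). cnj (A $$ (j, i)))"
  unfolding mat_adjoint_def by (rule eq_matI) (auto simp: mat_of_rows_def)

lemma adjoint_dim [simp]:
  fixes A :: "complex mat"
  shows "dim_row (mat_adjoint A) = dim_col A" "dim_col (mat_adjoint A) = dim_row A"
  by (simp_all add: mat_adjoint_eq)

lemma adjoint_carrier [simp]:
  fixes A :: "complex mat"
  shows "A \<in> carrier_mat n m \<Longrightarrow> mat_adjoint A \<in> carrier_mat m n"
  by (auto simp: mat_adjoint_eq)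

lemma adjoint_index [simp]:
  fixes A :: "complex mat"
  shows "i < dim_col A \<Longrightarrow> j < dim_row A \<Longrightarrow> mat_adjoint A $$ (i, j) = cnj (A $$ (j, i))"
  by (simp add: mat_adjoint_eq)

lemma adjoint_adjoint [simp]: "mat_adjoint (mat_adjoint (A :: complex mat)) = A"
  by (rule eq_matI) auto

lemma mult_index_sum:
  fixes A B :: "'a :: semiring_0 mat"
  assumes "i < dim_row A" "j < dim_col B" "dim_row B = dim_col A"
  shows "(A * B) $$ (i, j) = (\<Sum>l<dim_col A. A $$ (i, l) * B $$ (l, j))"
  using assms by (auto simp: scalar_prod_def lessThan_atLeast0 intro!: sum.cong)

lemma adjoint_mult:
  fixes A B :: "complex mat"
  assumes "A \<in> carrier_mat n m" "B \<in> carrier_mat m p"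
  shows "mat_adjoint (A * B) = mat_adjoint B * mat_adjoint A"
  using assms by (intro eq_matI) (auto simp: mult_index_sum mult.commute simp del: index_mult_mat(1) intro!: sum.cong)

lemma adjoint_add:
  fixes A B :: "complex mat"
  assumes "A \<in> carrier_mat n m" "B \<in> carrier_mat n m"
  shows "mat_adjoint (A + B) = mat_adjoint A + mat_adjoint B"
  using assms by (intro eq_matI) auto

lemma adjoint_minus:
  fixes A B :: "complex mat"
  assumes "A \<in> carrier_mat n m" "B \<in> carrier_mat n m"
  shows "mat_adjoint (A - B) = mat_adjoint A - mat_adjoint B"
  using assms by (intro eq_matI) auto

lemma adjoint_one [simp]: "mat_adjoint (1\<^sub>m n :: complex mat) = 1\<^sub>m n"
  by (rule eq_matI) auto

lemma adjoint_zero [simp]: "mat_adjoint (0\<^sub>m n m :: complex mat) = 0\<^sub>m m n"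
  by (rule eq_matI) auto

text \<open>Dimension equations as premises, instead of carriers with free dimensions, let the
  simplifier use this and the next four rules without instantiation.\<close>

lemma mult_assoc_dim:
  "dim_col A = dim_row B \<Longrightarrow> dim_col B = dim_row C \<Longrightarrow> A * B * C = A * (B * (C :: 'a :: semiring_0 mat))"
  by (rule assoc_mult_mat) auto

lemma add_mult_dim:
  "dim_row A = dim_row B \<Longrightarrow> dim_col A = dim_col B \<Longrightarrow> dim_col B = dim_row C \<Longrightarrow>
    (A + B) * C = A * C + B * (C :: 'a :: semiring_0 mat)"
  by (rule add_mult_distrib_mat) auto

lemma mult_add_dim:
  "dim_row A = dim_row B \<Longrightarrow> dim_col A = dim_col B \<Longrightarrow> dim_col C = dim_row B \<Longrightarrow>
    C * (A + B) = C * A + C * (B :: 'a :: semiring_0 mat)"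
  by (rule mult_add_distrib_mat) auto

lemma minus_mult_dim:
  "dim_row A = dim_row B \<Longrightarrow> dim_col A = dim_col B \<Longrightarrow> dim_col B = dim_row C \<Longrightarrow>
    (A - B) * C = A * C - B * (C :: 'a :: ring mat)"
  by (rule minus_mult_distrib_mat) auto

lemma mult_minus_dim:
  "dim_row A = dim_row B \<Longrightarrow> dim_col A = dim_col B \<Longrightarrow> dim_col C = dim_row B \<Longrightarrow>
    C * (A - B) = C * A - C * (B :: 'a :: ring mat)"
  by (rule mult_minus_distrib_mat) auto

lemma mtrace_carrier: "A \<in> carrier_mat n m \<Longrightarrow> mtrace A = (\<Sum>i<n. A $$ (i, i))"
  by (auto simp: mtrace_def)

lemma mtrace_mult:
  assumes "A \<in> carrier_mat n m" "B \<in> carrier_mat m n"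
  shows "mtrace (A * B) = (\<Sum>i<n. \<Sum>j<m. A $$ (i, j) * B $$ (j, i))"
  using assms by (auto simp: mtrace_def mult_index_sum simp del: index_mult_mat(1))

lemma mtrace_mult_commute:
  assumes "A \<in> carrier_mat n m" "B \<in> carrier_mat m n"
  shows "mtrace (A * B) = mtrace (B * A)"
  unfolding mtrace_mult[OF assms] mtrace_mult[OF assms(2,1)]
  by (subst sum.swap) (simp add: mult.commute)

lemma mtrace_add:
  assumes "A \<in> carrier_mat n n" "B \<in> carrier_mat n n"
  shows "mtrace (A + B) = mtrace A + mtrace B"
  using assms by (auto simp: mtrace_def sum.distrib)

lemma mtrace_minus:
  assumes "A \<in> carrier_mat n n" "B \<in> carrier_mat n n"
  shows "mtrace (A - B) = mtrace A - mtrace B"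
  using assms by (auto simp: mtrace_def sum_subtractf)

lemma mtrace_smult:
  assumes "A \<in> carrier_mat n n"
  shows "mtrace (c \<cdot>\<^sub>m A) = c * mtrace A"
  using assms by (auto simp: mtrace_def sum_distrib_left)

lemma mtrace_one [simp]: "mtrace (1\<^sub>m n) = of_nat n"
  by (simp add: mtrace_def)

lemma mtrace_zero [simp]: "mtrace (0\<^sub>m n n) = 0"
  by (simp add: mtrace_def)

section \<open>Kronecker products\<close>

text \<open>The index of a pair is \<open>i * n + j\<close>, the layout that \<open>kron\<close>
  decodes by \<open>div\<close> and \<open>mod\<close>; sums over a tensor product space are split
  this way.\<close>

lemma sum_lessThan_mult:
  fixes f :: "nat \<Rightarrow> 'a :: comm_monoid_add"
  shows "(\<Sum>i<m * n. f i) = (\<Sum>i<m. \<Sum>j<n. f (i * n + j))"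
proof (induction m)
  case (Suc m)
  have "(\<Sum>i<Suc m * n. f i) = sum f {0..<m * n + n}"
    by (simp add: lessThan_atLeast0 add.commute)
  also have "\<dots> = sum f {0..<m * n} + sum f {m * n..<m * n + n}"
    by (rule sum.atLeastLessThan_concat[symmetric]) auto
  also have "sum f {m * n..<m * n + n} = (\<Sum>j<n. f (m * n + j))"
    using sum.shift_bounds_nat_ivl[of f 0 "m * n" n]
    by (simp add: lessThan_atLeast0 add.commute)
  finally show ?case using Suc by (simp add: lessThan_atLeast0)
qed simp

lemma mult_add_less: "(i::nat) < m \<Longrightarrow> j < n \<Longrightarrow> i * n + j < m * n"
proof -
  assume "i < m" "j < n"
  then have "i * n + j < Suc i * n" "Suc i * n \<le> m * n"
    by (simp, intro mult_le_mono1) auto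
  then show ?thesis by linarith
qed

lemma kron_dim [simp]:
  "dim_row (kron A B) = dim_row A * dim_row B" "dim_col (kron A B) = dim_col A * dim_col B"
  by (simp_all add: kron_def)

lemma kron_carrier [simp]:
  "A \<in> carrier_mat n m \<Longrightarrow> B \<in> carrier_mat p q \<Longrightarrow> kron A B \<in> carrier_mat (n * p) (m * q)"
  by (auto simp: kron_def)

lemma kron_index:
  "i < dim_row A * dim_row B \<Longrightarrow> j < dim_col A * dim_col B \<Longrightarrow>
    kron A B $$ (i, j) = A $$ (i div dim_row B, j div dim_col B) * B $$ (i mod dim_row B, j mod dim_col B)"
  by (simp add: kron_def)

lemma div_mod_less:
  assumes "(i::nat) < m * n"
  shows "i div n < m" "i mod n < n"
proof -
  have "n > 0" using assms by (cases n) auto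
  then show "i div n < m" "i mod n < n"
    using assms by (auto simp: less_mult_imp_div_less)
qed

lemma kron_block:
  assumes "A \<in> carrier_mat m m'" "B \<in> carrier_mat n n'" "i < m" "j < m'" "r < n" "s < n'"
  shows "kron A B $$ (i * n + r, j * n' + s) = A $$ (i, j) * B $$ (r, s)"
  using assms by (subst kron_index) (auto intro: mult_add_less)

lemma kron_mult:
  assumes "A \<in> carrier_mat n m" "C \<in> carrier_mat m p" "B \<in> carrier_mat n' m'" "D \<in> carrier_mat m' p'"
  shows "kron A B * kron C D = kron (A * C) (B * D)"
proof (rule eq_matI)
  fix i j assume "i < dim_row (kron (A * C) (B * D))" "j < dim_col (kron (A * C) (B * D))"
  then have i: "i < n * n'" and j: "j < p * p'" using assms by auto
  note ij = div_mod_less[OF i] div_mod_less[OF j]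
  have "(kron A B * kron C D) $$ (i, j) = (\<Sum>l<m * m'. kron A B $$ (i, l) * kron C D $$ (l, j))"
    using i j assms by (subst mult_index_sum) auto
  also have "\<dots> = (\<Sum>l<m. \<Sum>l'<m'. kron A B $$ (i, l * m' + l') * kron C D $$ (l * m' + l', j))"
    by (rule sum_lessThan_mult)
  also have "\<dots> = (\<Sum>l<m. \<Sum>l'<m'. (A $$ (i div n', l) * C $$ (l, j div p')) * (B $$ (i mod n', l') * D $$ (l', j mod p')))"
  proof (intro sum.cong refl)
    fix l l' assume "l \<in> {..<m}" "l' \<in> {..<m'}"
    then show "kron A B $$ (i, l * m' + l') * kron C D $$ (l * m' + l', j)
        = (A $$ (i div n', l) * C $$ (l, j div p')) * (B $$ (i mod n', l') * D $$ (l', j mod p'))"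
      using i j assms mult_add_less[of l m l' m'] by (auto simp: kron_index)
  qed
  also have "\<dots> = (\<Sum>l<m. A $$ (i div n', l) * C $$ (l, j div p')) * (\<Sum>l'<m'. B $$ (i mod n', l') * D $$ (l', j mod p'))"
    by (simp add: sum_product)
  also have "\<dots> = (A * C) $$ (i div n', j div p') * (B * D) $$ (i mod n', j mod p')"
    using assms ij by (simp add: mult_index_sum del: index_mult_mat(1))
  also have "\<dots> = kron (A * C) (B * D) $$ (i, j)"
    using assms i j by (subst kron_index) auto
  finally show "(kron A B * kron C D) $$ (i, j) = kron (A * C) (B * D) $$ (i, j)" .
qed (use assms in auto)

lemma kron_adjoint: "mat_adjoint (kron A B) = kron (mat_adjoint A) (mat_adjoint B)"
  by (rule eq_matI) (auto simp: kron_index div_mod_less)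

lemma kron_one: "kron (1\<^sub>m n) (1\<^sub>m m) = 1\<^sub>m (n * m)"
proof (rule eq_matI)
  fix i j assume "i < dim_row (1\<^sub>m (n * m) :: complex mat)" "j < dim_col (1\<^sub>m (n * m) :: complex mat)"
  then have i: "i < n * m" and j: "j < n * m" by auto
  have "i = j \<longleftrightarrow> i div m = j div m \<and> i mod m = j mod m"
    by (metis div_mod_decomp)
  then show "kron (1\<^sub>m n) (1\<^sub>m m) $$ (i, j) = 1\<^sub>m (n * m) $$ (i, j)"
    using i j by (auto simp: kron_index div_mod_less)
qed auto

lemma kron_zero_left [simp]: "kron (0\<^sub>m n m) A = 0\<^sub>m (n * dim_row A) (m * dim_col A)"
  by (rule eq_matI) (auto simp: kron_index div_mod_less)

lemma kron_add_left:
  assumes "A \<in> carrier_mat n m" "B \<in> carrier_mat n m"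
  shows "kron (A + B) C = kron A C + kron B C"
  using assms by (intro eq_matI) (auto simp: kron_index div_mod_less algebra_simps)

lemma kron_smult_left: "kron (c \<cdot>\<^sub>m A) B = c \<cdot>\<^sub>m kron A B"
  by (intro eq_matI) (auto simp: kron_index div_mod_less algebra_simps)

lemma mtrace_kron:
  assumes "A \<in> carrier_mat n n" "B \<in> carrier_mat m m"
  shows "mtrace (kron A B) = mtrace A * mtrace B"
proof -
  have "mtrace (kron A B) = (\<Sum>i<n. \<Sum>j<m. kron A B $$ (i * m + j, i * m + j))"
    using assms by (simp add: mtrace_def sum_lessThan_mult)
  also have "\<dots> = (\<Sum>i<n. \<Sum>j<m. A $$ (i, i) * B $$ (j, j))"
    using kron_block[OF assms] by (intro sum.cong refl) auto
  also have "\<dots> = mtrace A * mtrace B"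
    using assms by (simp add: mtrace_def sum_product)
  finally show ?thesis .
qed

section \<open>Positive semidefinite matrices\<close>

lemma quad_form_sum:
  assumes "A \<in> carrier_mat d d" "v \<in> carrier_vec d"
  shows "conjugate v \<bullet> (A *\<^sub>v v) = (\<Sum>i<d. \<Sum>j<d. cnj (v $ i) * A $$ (i, j) * v $ j)"
  using assms by (auto simp: scalar_prod_def lessThan_atLeast0 sum_distrib_left mult.assoc intro!: sum.cong)

text \<open>The order on \<open>complex\<close> says at once that a number is real and nonnegative.
  Test vectors become functions, which can be updated and restricted without carrier side
  conditions.\<close>

lemma psd_iff:
  "psd d A \<longleftrightarrow> A \<in> carrier_mat d d \<and>
    (\<forall>v. 0 \<le> (\<Sum>i<d. \<Sum>j<d. cnj (v i) * A $$ (i, j) * v j))"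
proof -
  have "(\<forall>v \<in> carrier_vec d. 0 \<le> conjugate v \<bullet> (A *\<^sub>v v)) \<longleftrightarrow>
      (\<forall>v. 0 \<le> (\<Sum>i<d. \<Sum>j<d. cnj (v i) * A $$ (i, j) * v j))" (is "?L \<longleftrightarrow> ?R")
    if A: "A \<in> carrier_mat d d"
  proof
    assume L: ?L
    show ?R
    proof
      fix v :: "nat \<Rightarrow> complex"
      have "0 \<le> conjugate (vec d v) \<bullet> (A *\<^sub>v vec d v)" using L by auto
      then show "0 \<le> (\<Sum>i<d. \<Sum>j<d. cnj (v i) * A $$ (i, j) * v j)"
        by (subst (asm) quad_form_sum[OF A]) auto
    qed
  next
    assume ?R then show ?L using quad_form_sum[OF A] by auto
  qed
  then show ?thesis
    unfolding psd_def by (auto simp: less_eq_complex_def)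
qed

lemma psd_carrier: "psd d A \<Longrightarrow> A \<in> carrier_mat d d"
  by (simp add: psd_def)

definition quad_form :: "nat \<Rightarrow> complex mat \<Rightarrow> (nat \<Rightarrow> complex) \<Rightarrow> complex" where
  "quad_form d A v = (\<Sum>i<d. \<Sum>j<d. cnj (v i) * A $$ (i, j) * v j)"

lemma psd_iff_quad_form: "psd d A \<longleftrightarrow> A \<in> carrier_mat d d \<and> (\<forall>v. 0 \<le> quad_form d A v)"
  by (simp add: psd_iff quad_form_def)

lemma quad_form_add:
  "A \<in> carrier_mat d d \<Longrightarrow> B \<in> carrier_mat d d \<Longrightarrow> quad_form d (A + B) v = quad_form d A v + quad_form d B v"
  by (simp add: quad_form_def sum.distrib distrib_left distrib_right)

lemma quad_form_minus:
  "A \<in> carrier_mat d d \<Longrightarrow> B \<in> carrier_mat d d \<Longrightarrow> quad_form d (A - B) v = quad_form d A v - quad_form d B v"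
  by (simp add: quad_form_def sum_subtractf left_diff_distrib right_diff_distrib)

lemma quad_form_smult:
  "A \<in> carrier_mat d d \<Longrightarrow> quad_form d (c \<cdot>\<^sub>m A) v = c * quad_form d A v"
  by (simp add: quad_form_def sum_distrib_left mult_ac)

lemma quad_form_one: "quad_form d (1\<^sub>m d) v = of_real (\<Sum>i<d. (cmod (v i))\<^sup>2)"
  unfolding quad_form_def of_real_sum complex_norm_square
  by (intro sum.cong refl) (simp add: if_distrib[of "\<lambda>z. _ * z"] if_distrib[of "\<lambda>z. z * _"] mult.commute cong: if_cong)

text \<open>The form is the squared norm of the adjoint of \<open>C\<close> applied to
  \<open>v\<close>; the inner sum is its entry \<open>l\<close> up to conjugation.\<close>

lemma quad_form_gram:
  assumes C: "C \<in> carrier_mat d e"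
  shows "quad_form d (C * mat_adjoint C) v = of_real (\<Sum>l<e. (cmod (\<Sum>i<d. cnj (v i) * C $$ (i, l)))\<^sup>2)"
proof -
  have "quad_form d (C * mat_adjoint C) v
    = (\<Sum>i<d. \<Sum>j<d. \<Sum>l<e. (cnj (v i) * C $$ (i, l)) * cnj (cnj (v j) * C $$ (j, l)))"
    unfolding quad_form_def using C by (intro sum.cong refl)
      (auto simp: mult_index_sum sum_distrib_left sum_distrib_right algebra_simps simp del: index_mult_mat(1))
  also have "\<dots> = (\<Sum>i<d. \<Sum>l<e. \<Sum>j<d. (cnj (v i) * C $$ (i, l)) * cnj (cnj (v j) * C $$ (j, l)))"
    by (intro sum.cong refl sum.swap)
  also have "\<dots> = (\<Sum>l<e. \<Sum>i<d. \<Sum>j<d. (cnj (v i) * C $$ (i, l)) * cnj (cnj (v j) * C $$ (j, l)))"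
    by (rule sum.swap)
  also have "\<dots> = (\<Sum>l<e. (\<Sum>i<d. cnj (v i) * C $$ (i, l)) * cnj (\<Sum>i<d. cnj (v i) * C $$ (i, l)))"
    by (simp add: sum_product)
  finally show ?thesis by (simp only: of_real_sum complex_norm_square)
qed

lemma psd_add: "psd d A \<Longrightarrow> psd d B \<Longrightarrow> psd d (A + B)"
  by (auto simp: psd_iff_quad_form quad_form_add)

lemma psd_smult: "psd d A \<Longrightarrow> 0 \<le> (c :: real) \<Longrightarrow> psd d (of_real c \<cdot>\<^sub>m A)"
  by (auto simp: psd_iff_quad_form quad_form_smult less_eq_complex_def)

lemma psd_mult_adjoint: "C \<in> carrier_mat d e \<Longrightarrow> psd d (C * mat_adjoint C)"
  by (auto simp: psd_iff_quad_form quad_form_gram less_eq_complex_def intro!: sum_nonneg simp del: of_real_sum)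

lemma psd_one: "psd d (1\<^sub>m d)"
  using psd_mult_adjoint[of "1\<^sub>m d" d d] by simp

text \<open>Cholesky factorisation, splitting off the last index. If the pivot \<open>A n n\<close>
  is zero, its row and column vanish; otherwise the Schur complement is again positive semidefinite.
  Functions of indices keep submatrices out of the induction. Later arguments treat a state through
  such a factor.\<close>

lemma psd_form_factor:
  fixes A :: "nat \<Rightarrow> nat \<Rightarrow> complex"
  assumes "\<And>v. 0 \<le> (\<Sum>i<n. \<Sum>j<n. cnj (v i) * A i j * v j)"
  shows "\<exists>C. \<forall>i<n. \<forall>j<n. A i j = (\<Sum>r<n. C i r * cnj (C j r))"
  using assms
proof (induction n arbitrary: A)
  case (Suc n)
  define a where "a = A n n"
  \<comment> \<open>Test vectors with last coordinate \<open>x\<close>; below they are specialised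
    to support on one further index.\<close>
  have expand: "0 \<le> (\<Sum>i<n. \<Sum>j<n. cnj (v i) * A i j * v j) + (\<Sum>i<n. cnj (v i) * A i n) * x
      + cnj x * (\<Sum>j<n. A n j * v j) + cnj x * a * x" for v x
    using Suc.prems[of "v(n := x)"]
    by (simp add: sum.distrib sum_distrib_left sum_distrib_right mult.assoc a_def algebra_simps)
  have two: "0 \<le> cnj t * A i i * t + cnj t * A i n * x + cnj x * (A n i * t) + cnj x * a * x"
    if "i < n" for i t x
    using expand[of "\<lambda>k. if k = i then t else 0" x] that
    by (simp add: if_distrib[of cnj] if_distrib[of "\<lambda>z. _ * z"] if_distrib[of "\<lambda>z. z * _"] cong: if_cong)
  have a0: "0 \<le> a"
    using expand[of "\<lambda>k. 0" 1] by simp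
  have diag: "0 \<le> A i i" if "i < n" for i
    using two[OF that, of 1 0] by simp
  \<comment> \<open>The values at (1, 1) and (1, \<i>) must be real, which forces the symmetric
    entries to be conjugate.\<close>
  have herm: "A n i = cnj (A i n)" if i: "i < n" for i
    using two[OF i, of 1 1] two[OF i, of 1 \<i>] diag[OF i] a0
    by (auto simp: less_eq_complex_def complex_eq_iff)
  show ?case
  proof (cases "a = 0")
    case True
    have zero: "A i n = 0" if i: "i < n" for i
    proof (rule ccontr)
      assume nz: "A i n \<noteq> 0"
      define m where "m = (cmod (A i n))\<^sup>2"
      have m: "m > 0" and mm: "A i n * cnj (A i n) = of_real m"
        using nz by (simp_all add: m_def complex_norm_square del: of_real_power)
      \<comment> \<open>With a zero pivot the form is affine in the last coordinate; this
        \<open>s\<close> makes its value at the vector below equal to -1.\<close>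
      define s where "s = (Re (A i i) + 1) / (2 * m)"
      have "0 \<le> A i i - 2 * of_real s * (A i n * cnj (A i n))"
        using two[OF i, of 1 "- of_real s * cnj (A i n)"] herm[OF i] True by (simp add: algebra_simps)
      then have "0 \<le> Re (A i i) - 2 * s * m"
        unfolding mm by (auto simp: less_eq_complex_def)
      then show False using m by (simp add: s_def)
    qed
    have "0 \<le> (\<Sum>i<n. \<Sum>j<n. cnj (v i) * A i j * v j)" for v
      using expand[of v 0] by simp
    from Suc.IH[OF this] obtain C where C: "\<And>i j. i < n \<Longrightarrow> j < n \<Longrightarrow> A i j = (\<Sum>r<n. C i r * cnj (C j r))"
      by blast
    define C' where "C' = (\<lambda>i r. if i < n \<and> r < n then C i r else 0)"
    have "A i j = (\<Sum>r<Suc n. C' i r * cnj (C' j r))" if "i < Suc n" "j < Suc n" for i j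
      using that C zero herm True by (cases "i = n"; cases "j = n") (auto simp: C'_def a_def)
    then show ?thesis by blast
  next
    case False
    define q where "q = complex_of_real (sqrt (Re a))"
    have q: "q * q = a" "cnj q = q" "q \<noteq> 0" "cnj a = a"
      using a0 False by (auto simp: q_def less_eq_complex_def complex_eq_iff simp flip: of_real_mult)
    define A' where "A' i j = A i j - A i n * A n j / a" for i j
    have "0 \<le> (\<Sum>i<n. \<Sum>j<n. cnj (v i) * A' i j * v j)" for v
    proof -
      define \<beta> where "\<beta> = (\<Sum>j<n. A n j * v j)"
      define \<gamma> where "\<gamma> = (\<Sum>i<n. cnj (v i) * A i n)"
      have "\<gamma> * \<beta> / a = (\<Sum>i<n. \<Sum>j<n. cnj (v i) * (A i n * A n j / a) * v j)"
        unfolding \<beta>_def \<gamma>_def sum_product sum_divide_distrib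
        by (intro sum.cong refl) (simp add: mult_ac)
      then have "(\<Sum>i<n. \<Sum>j<n. cnj (v i) * A' i j * v j)
          = (\<Sum>i<n. \<Sum>j<n. cnj (v i) * A i j * v j) - \<gamma> * \<beta> / a"
        by (simp add: A'_def left_diff_distrib right_diff_distrib sum_subtractf)
      \<comment> \<open>The form of the Schur complement is the form of \<open>A\<close> minimised
        over the last coordinate, with minimiser \<open>- \<beta> / a\<close>.\<close>
      also have "\<dots> = (\<Sum>i<n. \<Sum>j<n. cnj (v i) * A i j * v j) + \<gamma> * (- \<beta> / a)
          + cnj (- \<beta> / a) * \<beta> + cnj (- \<beta> / a) * a * (- \<beta> / a)"
        using False q(4) by (simp add: field_simps)
      also have "\<dots> \<ge> 0"
        unfolding \<beta>_def \<gamma>_def by (rule expand)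
      finally show ?thesis .
    qed
    from Suc.IH[OF this] obtain C where C: "\<And>i j. i < n \<Longrightarrow> j < n \<Longrightarrow> A' i j = (\<Sum>r<n. C i r * cnj (C j r))"
      by blast
    \<comment> \<open>The new column carries the rank-one part that was subtracted; row
      \<open>n\<close> of the old columns is zero.\<close>
    define C' where "C' = (\<lambda>i r. if r = n then A i n / q else if i < n then C i r else 0)"
    have "A i j = (\<Sum>r<Suc n. C' i r * cnj (C' j r))" if "i < Suc n" "j < Suc n" for i j
    proof -
      have last: "C' i n * cnj (C' j n) = A i n * A n j / a"
        using that q herm[of j] by (cases "j = n") (auto simp: C'_def a_def)
      have "(\<Sum>r<n. C' i r * cnj (C' j r)) = A i j - A i n * A n j / a"
      proof (cases "i < n \<and> j < n")
        case True
        then show ?thesis by (simp add: C'_def A'_def flip: C)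
      next
        case neq: False
        then have "i = n \<or> j = n" using that by auto
        then show ?thesis using False by (auto simp: C'_def a_def)
      qed
      then show ?thesis using last by simp
    qed
    then show ?thesis by blast
  qed
qed simp

lemma psd_factor:
  assumes "psd d A"
  obtains C where "C \<in> carrier_mat d d" "A = C * mat_adjoint C"
proof -
  from psd_form_factor[where n = d and A = "\<lambda>i j. A $$ (i, j)"] assms
  obtain C where C: "\<And>i j. i < d \<Longrightarrow> j < d \<Longrightarrow> A $$ (i, j) = (\<Sum>r<d. C i r * cnj (C j r))"
    unfolding psd_iff by blast
  show thesis
  proof (rule that[of "mat d d (\<lambda>(i, j). C i j)"])
    show "A = mat d d (\<lambda>(i, j). C i j) * mat_adjoint (mat d d (\<lambda>(i, j). C i j))"
      using psd_carrier[OF assms]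
      by (intro eq_matI) (auto simp: mult_index_sum C simp del: index_mult_mat(1))
  qed simp
qed

text \<open>The product of the factors is a factor of the product.\<close>

lemma psd_kron:
  assumes "psd m A" "psd n B"
  shows "psd (m * n) (kron A B)"
proof -
  obtain C D where C: "C \<in> carrier_mat m m" "A = C * mat_adjoint C"
    and D: "D \<in> carrier_mat n n" "B = D * mat_adjoint D"
    using assms psd_factor by metis
  have "kron A B = kron C D * mat_adjoint (kron C D)"
    unfolding kron_adjoint C D using C(1) D(1) by (intro kron_mult[symmetric]) auto
  then show ?thesis
    using psd_mult_adjoint[of "kron C D" "m * n" "m * n"] C(1) D(1) by simp
qed

lemma psd_congruence:
  assumes "psd d A" "L \<in> carrier_mat m d"
  shows "psd m (L * A * mat_adjoint L)"
proof -
  obtain C where C: "C \<in> carrier_mat d d" "A = C * mat_adjoint C"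
    using assms psd_factor by metis
  have "L * A * mat_adjoint L = (L * C) * mat_adjoint (L * C)"
    unfolding C(2) adjoint_mult[OF assms(2) C(1)]
    using C(1) assms(2) by (auto simp: mult_assoc_dim)
  then show ?thesis
    using psd_mult_adjoint[of "L * C" m d] assms(2) C(1) by simp
qed

lemma density_carrier: "density d \<rho> \<Longrightarrow> \<rho> \<in> carrier_mat d d"
  by (simp add: density_def psd_carrier)

lemma density_kron:
  assumes "density m A" "density n B"
  shows "density (m * n) (kron A B)"
  using assms mtrace_kron[of A m B n] by (auto simp: density_def psd_kron psd_carrier)

section \<open>Frobenius norm and projectors\<close>

text \<open>A state \<open>C * mat_adjoint C\<close> is handled through its factor \<open>C\<close>,
  in effect a purification: an operator acts by multiplying \<open>C\<close> from the left, the
  trace becomes the squared Frobenius norm, and the triangle inequality is available.\<close>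

definition fnorm :: "complex mat \<Rightarrow> real" where
  "fnorm M = L2_set (\<lambda>p. cmod (M $$ p)) ({..<dim_row M} \<times> {..<dim_col M})"

lemma fnorm_nonneg [simp]: "0 \<le> fnorm M"
  by (simp add: fnorm_def)

lemma fnorm_square: "complex_of_real ((fnorm M)\<^sup>2) = mtrace (M * mat_adjoint M)"
  by (simp add: fnorm_def L2_set_def sum_nonneg mtrace_def mult_index_sum complex_norm_square[symmetric]
      sum.cartesian_product case_prod_beta del: index_mult_mat(1) of_real_power)

lemma psd_mtrace_nonneg:
  assumes "psd d A"
  shows "0 \<le> mtrace A"
proof -
  obtain C where "A = C * mat_adjoint C" using assms psd_factor by metis
  then have "mtrace A = complex_of_real ((fnorm C)\<^sup>2)" by (simp only: fnorm_square)
  then show ?thesis by (simp add: less_eq_complex_def)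
qed

lemma fnorm_triangle:
  assumes "A \<in> carrier_mat n m" "B \<in> carrier_mat n m"
  shows "fnorm (A + B) \<le> fnorm A + fnorm B"
proof -
  have "fnorm (A + B) \<le> L2_set (\<lambda>p. cmod (A $$ p) + cmod (B $$ p)) ({..<n} \<times> {..<m})"
    using assms unfolding fnorm_def
    by (auto intro!: L2_set_mono norm_triangle_ineq)
  also have "\<dots> \<le> L2_set (\<lambda>p. cmod (A $$ p)) ({..<n} \<times> {..<m}) + L2_set (\<lambda>p. cmod (B $$ p)) ({..<n} \<times> {..<m})"
    by (rule L2_set_triangle_ineq)
  also have "\<dots> = fnorm A + fnorm B"
    using assms by (simp add: fnorm_def)
  finally show ?thesis .
qed

lemma projector_carrier: "projector d P \<Longrightarrow> P \<in> carrier_mat d d"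
  by (simp add: projector_def)

lemma projector_complement:
  assumes "projector d P"
  shows "projector d (1\<^sub>m d - P)"
proof -
  have P: "P \<in> carrier_mat d d" "P * P = P" "mat_adjoint P = P"
    using assms by (auto simp: projector_def)
  have "P - P = 0\<^sub>m d d" "(1\<^sub>m d - P) - 0\<^sub>m d d = 1\<^sub>m d - P" using P by auto
  then have "(1\<^sub>m d - P) * (1\<^sub>m d - P) = 1\<^sub>m d - P"
    using P by (simp add: minus_mult_dim mult_minus_dim)
  then show ?thesis
    using P by (auto simp: projector_def adjoint_minus[of _ d d])
qed

text \<open>The Born rule: for the state \<open>X * mat_adjoint X\<close> the probability of passing
  \<open>P\<close> is a squared norm, by cyclicity of the trace and
  \<open>P * P = P\<close>.\<close>

lemma fnorm_projector_square:
  assumes P: "projector d P" and X: "X \<in> carrier_mat d m"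
  shows "complex_of_real ((fnorm (P * X))\<^sup>2) = mtrace (P * (X * mat_adjoint X))"
proof -
  have P': "P \<in> carrier_mat d d" "P * P = P" "mat_adjoint P = P"
    using P by (auto simp: projector_def)
  let ?R = "X * mat_adjoint X"
  have R: "?R \<in> carrier_mat d d" using X by auto
  have "(P * X) * mat_adjoint (P * X) = (P * ?R) * P"
    unfolding adjoint_mult[OF P'(1) X] P'(3)
    using P' X by (auto simp: mult_assoc_dim)
  then have "complex_of_real ((fnorm (P * X))\<^sup>2) = mtrace ((P * ?R) * P)"
    unfolding fnorm_square by simp
  also have "\<dots> = mtrace (P * (P * ?R))"
    using P' R by (intro mtrace_mult_commute[of _ d d]) auto
  also have "P * (P * ?R) = P * ?R"
    using P' R by (simp flip: assoc_mult_mat[of P d d P d ?R d])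
  finally show ?thesis .
qed

lemma fnorm_projector_pythagoras:
  assumes P: "projector d P" and X: "X \<in> carrier_mat d m"
  shows "(fnorm (P * X))\<^sup>2 + (fnorm ((1\<^sub>m d - P) * X))\<^sup>2 = (fnorm X)\<^sup>2"
proof -
  let ?R = "X * mat_adjoint X"
  have c: "P \<in> carrier_mat d d" "?R \<in> carrier_mat d d" using projector_carrier[OF P] X by auto
  have "complex_of_real ((fnorm (P * X))\<^sup>2 + (fnorm ((1\<^sub>m d - P) * X))\<^sup>2)
      = mtrace (P * ?R) + mtrace ((1\<^sub>m d - P) * ?R)"
    using fnorm_projector_square[OF P X] fnorm_projector_square[OF projector_complement[OF P] X] by simp
  also have "(1\<^sub>m d - P) * ?R = ?R - P * ?R"
    using c by (auto simp: minus_mult_dim)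
  also have "mtrace (P * ?R) + mtrace (?R - P * ?R) = mtrace ?R"
    using c by (subst mtrace_minus[of _ d]) auto
  also have "\<dots> = complex_of_real ((fnorm X)\<^sup>2)" by (rule fnorm_square[symmetric])
  finally show ?thesis by (simp only: of_real_eq_iff)
qed

lemma fnorm_projector_le:
  assumes P: "projector d P" and X: "X \<in> carrier_mat d m"
  shows "fnorm (P * X) \<le> fnorm X"
proof -
  have "(fnorm (P * X))\<^sup>2 \<le> (fnorm X)\<^sup>2"
    using fnorm_projector_pythagoras[OF assms] by (metis le_add_same_cancel1 zero_le_power2)
  then show ?thesis by (rule power2_le_imp_le) simp
qed

abbreviation branch :: "nat \<Rightarrow> complex mat \<Rightarrow> bool \<Rightarrow> complex mat" where
  "branch d P c \<equiv> if c then P else 1\<^sub>m d - P"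

lemma projector_branch:
  "projector d P \<Longrightarrow> projector d (branch d P c)"
  by (simp add: projector_complement)

lemma branch_orthogonal:
  assumes "projector d P"
  shows "branch d P c * branch d P (\<not> c) = 0\<^sub>m d d"
  using assms by (auto simp: projector_def minus_mult_dim mult_minus_dim intro!: eq_matI)

text \<open>\<open>prob_outcome\<close> takes a real part; the trace is a squared norm by the Born
  rule for a factor of \<open>\<rho>\<close>, so nothing is discarded.\<close>

lemma prob_outcome_eq:
  assumes P: "projector d P" and r: "density d \<rho>"
  shows "mtrace (branch d P c * \<rho>) = of_real (prob_outcome d P \<rho> c)"
    and "0 \<le> prob_outcome d P \<rho> c"
proof -
  obtain C where C: "C \<in> carrier_mat d d" "\<rho> = C * mat_adjoint C"
    using r psd_factor unfolding density_def by metis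
  have "mtrace (branch d P c * \<rho>) = complex_of_real ((fnorm (branch d P c * C))\<^sup>2)"
    unfolding C(2) using fnorm_projector_square[OF projector_branch[OF P] C(1)] by metis
  then show "mtrace (branch d P c * \<rho>) = of_real (prob_outcome d P \<rho> c)" "0 \<le> prob_outcome d P \<rho> c"
    unfolding prob_outcome_def by auto
qed

lemma prob_outcome_complement:
  assumes P: "projector d P" and r: "density d \<rho>"
  shows "prob_outcome d P \<rho> (\<not> c) = 1 - prob_outcome d P \<rho> c"
proof -
  have c: "P \<in> carrier_mat d d" "\<rho> \<in> carrier_mat d d" "mtrace \<rho> = 1"
    using projector_carrier[OF P] density_carrier[OF r] r by (auto simp: density_def)
  have "mtrace ((1\<^sub>m d - P) * \<rho>) = 1 - mtrace (P * \<rho>)"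
    using c by (simp add: minus_mult_dim mtrace_minus[of _ d])
  then show ?thesis by (cases c) (auto simp: prob_outcome_def)
qed

section \<open>Threshold decoding on tensor powers\<close>

fun kron_list :: "complex mat list \<Rightarrow> complex mat" where
  "kron_list [] = 1\<^sub>m 1"
| "kron_list (A # As) = kron A (kron_list As)"

text \<open>The projector onto the outcomes that disagree with \<open>w\<close> in fewer than \<open>t\<close> positions when each of the
  \<open>length w\<close> copies is measured with \<open>P\<close>.\<close>

fun near :: "nat \<Rightarrow> complex mat \<Rightarrow> bool list \<Rightarrow> nat \<Rightarrow> complex mat" where
  "near d P w 0 = 0\<^sub>m (d ^ length w) (d ^ length w)"
| "near d P [] (Suc t) = 1\<^sub>m 1"
| "near d P (c # w) (Suc t) =
     kron (branch d P c) (near d P w (Suc t)) + kron (branch d P (\<not> c)) (near d P w t)"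

text \<open>The volume of a Hamming ball, that is the sum of the binomial coefficients (k choose j)
  over j < t, by the recursion that \<open>near\<close> follows.\<close>

fun near_count :: "nat \<Rightarrow> nat \<Rightarrow> nat" where
  "near_count k 0 = 0"
| "near_count 0 (Suc t) = 1"
| "near_count (Suc k) (Suc t) = near_count k (Suc t) + near_count k t"

text \<open>The generating function bound: give words at distance j from a centre the weight
  \<open>\<theta> ^ j\<close>. The total weight is \<open>(1 + \<theta>) ^ k\<close>, and each word
  counted weighs at least \<open>\<theta> ^ t\<close> as \<open>\<theta>\<close> is at most
  1.\<close>

lemma near_count_bound:
  assumes "0 < \<theta>" "\<theta> \<le> (1::real)"
  shows "real (near_count k t) * \<theta> ^ t \<le> (1 + \<theta>) ^ k"
proof (induction k t rule: near_count.induct)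
  case (2 t)
  then show ?case using assms by (simp add: mult_le_one power_le_one)
next
  case (3 k t)
  have "real (near_count (Suc k) (Suc t)) * \<theta> ^ Suc t
      = real (near_count k (Suc t)) * \<theta> ^ Suc t + \<theta> * (real (near_count k t) * \<theta> ^ t)"
    by (simp add: algebra_simps)
  also have "\<dots> \<le> (1 + \<theta>) ^ k + \<theta> * (1 + \<theta>) ^ k"
    using 3 assms by (intro add_mono mult_left_mono) auto
  finally show ?case by (simp add: algebra_simps)
qed (use assms in auto)

text \<open>The cross terms of the square vanish because \<open>Q\<close> and \<open>Q'\<close> are
  orthogonal.\<close>

lemma projector_kron_add:
  assumes Q: "projector d Q" "projector d Q'" "Q * Q' = 0\<^sub>m d d" "Q' * Q = 0\<^sub>m d d"
    and A: "projector m A" and B: "projector m B"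
  shows "projector (d * m) (kron Q A + kron Q' B)"
proof -
  have c: "Q \<in> carrier_mat d d" "Q' \<in> carrier_mat d d" "A \<in> carrier_mat m m" "B \<in> carrier_mat m m"
    using assms projector_carrier by auto
  note km = kron_mult[of _ d d _ d _ m m _ m]
  have "(kron Q A + kron Q' B) * (kron Q A + kron Q' B)
     = (kron (Q * Q) (A * A) + kron (Q' * Q) (B * A)) + (kron (Q * Q') (A * B) + kron (Q' * Q') (B * B))"
    using c by (simp add: add_mult_dim mult_add_dim km)
  also have "\<dots> = kron Q A + kron Q' B"
    using Q A B c by (auto simp: projector_def intro!: eq_matI)
  finally have "(kron Q A + kron Q' B) * (kron Q A + kron Q' B) = kron Q A + kron Q' B" .
  moreover have "mat_adjoint (kron Q A + kron Q' B) = kron Q A + kron Q' B"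
    using assms c by (simp add: adjoint_add[of _ "d * m" "d * m"] kron_adjoint projector_def)
  ultimately show ?thesis using c by (simp add: projector_def)
qed

lemma near_projector:
  assumes "projector d P"
  shows "projector (d ^ length w) (near d P w t)"
  using assms
proof (induction d P w t rule: near.induct)
  case (1 d P w)
  then show ?case by (simp add: projector_def)
next
  case (2 d P t)
  then show ?case by (simp add: projector_def)
next
  case (3 d P c w t)
  then have P: "projector d P" by simp
  then show ?case
    using projector_kron_add[OF projector_branch[OF P] projector_branch[OF P]
        branch_orthogonal[OF P, of c] branch_orthogonal[OF P, of "\<not> c", unfolded not_not] 3(1,2)[OF P]] by simp
qed

lemma near_carrier [simp]:
  "projector d P \<Longrightarrow> near d P w t \<in> carrier_mat (d ^ length w) (d ^ length w)"
  by (intro projector_carrier near_projector)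

section \<open>Summing the projectors over all guesses\<close>

lemma sum_lists_Suc:
  fixes f :: "'a list \<Rightarrow> 'b :: comm_monoid_add"
  shows "(\<Sum>xs\<in>{xs. set xs \<subseteq> A \<and> length xs = Suc n}. f xs)
       = (\<Sum>x\<in>A. \<Sum>xs\<in>{xs. set xs \<subseteq> A \<and> length xs = n}. f (x # xs))"
proof -
  have "(\<Sum>xs\<in>{xs. set xs \<subseteq> A \<and> length xs = Suc n}. f xs)
     = sum f ((\<lambda>(xs, n). n # xs) ` ({xs. set xs \<subseteq> A \<and> length xs = n} \<times> A))"
    by (simp only: lists_length_Suc_eq)
  also have "\<dots> = (\<Sum>(xs, x)\<in>{xs. set xs \<subseteq> A \<and> length xs = n} \<times> A. f (x # xs))"
    by (subst sum.reindex) (auto simp: inj_on_def case_prod_beta)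
  also have "\<dots> = (\<Sum>xs\<in>{xs. set xs \<subseteq> A \<and> length xs = n}. \<Sum>x\<in>A. f (x # xs))"
    by (rule sum.cartesian_product[symmetric])
  also have "\<dots> = (\<Sum>x\<in>A. \<Sum>xs\<in>{xs. set xs \<subseteq> A \<and> length xs = n}. f (x # xs))"
    by (rule sum.swap)
  finally show ?thesis .
qed

abbreviation words :: "nat \<Rightarrow> bool list set" where
  "words k \<equiv> {w. set w \<subseteq> UNIV \<and> length w = k}"

text \<open>Summing over the first letter \<open>c\<close>, each branch in the recursion of
  \<open>near\<close> receives \<open>P\<close> and its complement once, which add up to the
  identity. So the projectors for all guesses add up to a multiple of the identity, and the multiple
  obeys the recursion of \<open>near_count\<close>.\<close>

lemma near_sum_entries:
  assumes P: "projector d P" and "i < d ^ k" "j < d ^ k"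
  shows "(\<Sum>w\<in>words k. near d P w t $$ (i, j)) = of_nat (near_count k t) * (if i = j then 1 else 0)"
  using assms(2,3)
proof (induction k t arbitrary: i j rule: near_count.induct)
  case (1 k)
  then show ?case by simp
next
  case (2 t)
  have "words 0 = {[]}" by auto
  then show ?case using 2 by simp
next
  case (3 k t)
  let ?m = "d ^ k"
  define i1 i2 j1 j2 where ij: "i1 = i div ?m" "i2 = i mod ?m" "j1 = j div ?m" "j2 = j mod ?m"
  have b: "i1 < d" "i2 < ?m" "j1 < d" "j2 < ?m"
    using 3 div_mod_less[of i d ?m] div_mod_less[of j d ?m] by (auto simp: ij)
  have eq: "i = j \<longleftrightarrow> i1 = j1 \<and> i2 = j2"
    unfolding ij by (metis div_mod_decomp)
  have Pc: "P \<in> carrier_mat d d" using P by (rule projector_carrier)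
  have nc: "near d P w s \<in> carrier_mat ?m ?m" if "w \<in> words k" for w s
    using near_carrier[OF P, of w s] that by simp
  have step: "near d P (c # w) (Suc t) $$ (i, j)
      = branch d P c $$ (i1, j1) * near d P w (Suc t) $$ (i2, j2)
        + branch d P (\<not> c) $$ (i1, j1) * near d P w t $$ (i2, j2)" if w: "w \<in> words k" for c w
    using nc[OF w, of t] nc[OF w, of "Suc t"] Pc 3(3,4) by (cases c) (auto simp: kron_index ij)
  have br: "branch d P True $$ (i1, j1) + branch d P False $$ (i1, j1) = (if i1 = j1 then 1 else 0)"
    using Pc b by auto
  have "(\<Sum>w\<in>words (Suc k). near d P w (Suc t) $$ (i, j))
      = (\<Sum>c\<in>UNIV. \<Sum>w\<in>words k. branch d P c $$ (i1, j1) * near d P w (Suc t) $$ (i2, j2)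
        + branch d P (\<not> c) $$ (i1, j1) * near d P w t $$ (i2, j2))"
    unfolding sum_lists_Suc using step by (intro sum.cong refl) auto
  also have "\<dots> = (branch d P True $$ (i1, j1) + branch d P False $$ (i1, j1)) *
      ((\<Sum>w\<in>words k. near d P w (Suc t) $$ (i2, j2)) + (\<Sum>w\<in>words k. near d P w t $$ (i2, j2)))"
    unfolding UNIV_bool by (simp add: sum.distrib sum_distrib_left[symmetric] distrib_left distrib_right add_ac)
  also have "\<dots> = of_nat (near_count (Suc k) (Suc t)) * (if i = j then 1 else 0)"
    unfolding br using 3(1)[OF b(2,4)] 3(2)[OF b(2,4)] eq by (simp add: distrib_right)
  finally show ?case .
qed

lemma near_sum_fnorm:
  assumes P: "projector d P" and X: "X \<in> carrier_mat (d ^ k) m"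
  shows "(\<Sum>w\<in>words k. (fnorm (near d P w t * X))\<^sup>2) = real (near_count k t) * (fnorm X)\<^sup>2"
proof -
  let ?R = "X * mat_adjoint X"
  have R: "?R \<in> carrier_mat (d ^ k) (d ^ k)" using X by auto
  have "complex_of_real (\<Sum>w\<in>words k. (fnorm (near d P w t * X))\<^sup>2) = (\<Sum>w\<in>words k. mtrace (near d P w t * ?R))"
    unfolding of_real_sum using fnorm_projector_square[OF near_projector[OF P]] X by (intro sum.cong) auto
  also have "\<dots> = (\<Sum>w\<in>words k. \<Sum>i<d ^ k. \<Sum>j<d ^ k. near d P w t $$ (i, j) * ?R $$ (j, i))"
    using near_carrier[OF P] R by (intro sum.cong refl mtrace_mult) auto
  also have "\<dots> = (\<Sum>i<d ^ k. \<Sum>w\<in>words k. \<Sum>j<d ^ k. near d P w t $$ (i, j) * ?R $$ (j, i))"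
    by (rule sum.swap)
  also have "\<dots> = (\<Sum>i<d ^ k. \<Sum>j<d ^ k. \<Sum>w\<in>words k. near d P w t $$ (i, j) * ?R $$ (j, i))"
    by (intro sum.cong refl sum.swap)
  also have "\<dots> = (\<Sum>i<d ^ k. \<Sum>j<d ^ k. of_nat (near_count k t) * (if i = j then 1 else 0) * ?R $$ (j, i))"
    unfolding sum_distrib_right[symmetric]
    by (intro sum.cong refl arg_cong2[of _ _ _ _ "(*)"] near_sum_entries[OF P]) auto
  also have "\<dots> = (\<Sum>i<d ^ k. of_nat (near_count k t) * ?R $$ (i, i))"
    by (intro sum.cong refl) (simp add: if_distrib[of "\<lambda>z. _ * z"] if_distrib[of "\<lambda>z. z * _"] cong: if_cong)
  also have "\<dots> = of_nat (near_count k t) * mtrace ?R"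
    using mtrace_carrier[OF R] by (simp add: sum_distrib_left)
  also have "\<dots> = complex_of_real (real (near_count k t) * (fnorm X)\<^sup>2)"
    by (simp only: fnorm_square[symmetric] of_real_mult of_real_of_nat_eq)
  finally show ?thesis by (simp only: of_real_eq_iff)
qed

lemma kron_list_density:
  "\<forall>\<rho>\<in>set \<rho>s. density d \<rho> \<Longrightarrow> density (d ^ length \<rho>s) (kron_list \<rho>s)"
proof (induction \<rho>s)
  case Nil
  show ?case using psd_one[of 1] by (simp add: density_def)
qed (auto intro: density_kron)

text \<open>The Chernoff bound. The number of wrong outcomes on a product state is a sum of
  independent indicators of probability at most \<open>\<epsilon>\<close>, so the expectation of
  \<open>\<mu>\<close> to this number is at most the numerator, and Markov's inequality bounds the
  tail from \<open>t\<close> on. The witness \<open>r\<close> is the probability of fewer than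
  \<open>t\<close> wrong outcomes; the induction conditions on the first copy.\<close>

lemma near_success:
  assumes P: "projector d P" and "0 \<le> \<epsilon>" "1 \<le> (\<mu> :: real)"
    and "list_all2 (\<lambda>c \<rho>. density d \<rho> \<and> 1 - \<epsilon> \<le> prob_outcome d P \<rho> c) w \<rho>s"
  shows "\<exists>r. mtrace (near d P w t * kron_list \<rho>s) = of_real r \<and> r \<le> 1 \<and>
    1 - r \<le> (1 - \<epsilon> + \<epsilon> * \<mu>) ^ length w / \<mu> ^ t"
  using assms(4)
proof (induction arbitrary: t rule: list_all2_induct)
  case Nil
  have "1\<^sub>m 1 * 1\<^sub>m 1 = (1\<^sub>m 1 :: complex mat)" by simp
  then show ?case
    using assms by (cases t) (auto intro!: exI[of _ "0::real"] exI[of _ "1::real"])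
next
  case (Cons c w \<rho> \<rho>s)
  define G where "G = 1 - \<epsilon> + \<epsilon> * \<mu>"
  have "\<epsilon> * 1 \<le> \<epsilon> * \<mu>" using assms by (intro mult_left_mono) auto
  then have G1: "1 \<le> G" unfolding G_def by simp
  have len: "length w = length \<rho>s" using Cons(2) by (rule list_all2_lengthD)
  have dens: "density (d ^ length w) (kron_list \<rho>s)"
    unfolding len using Cons(2) by (intro kron_list_density) (auto simp: list_all2_conv_all_nth in_set_conv_nth)
  then have Rc: "kron_list \<rho>s \<in> carrier_mat (d ^ length w) (d ^ length w)" by (rule density_carrier)
  have \<rho>: "density d \<rho>" "\<rho> \<in> carrier_mat d d" using Cons(1) density_carrier by auto
  have bc: "branch d P c \<in> carrier_mat d d" for c using projector_carrier[OF projector_branch[OF P]] .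
  show ?case
  proof (cases t)
    \<comment> \<open>Nothing passes at threshold 0, so \<open>r\<close> is 0; the bound still holds
      because \<open>G\<close> is at least 1.\<close>
    case 0
    have "0\<^sub>m (d ^ length (c # w)) (d ^ length (c # w)) * kron_list (\<rho> # \<rho>s) = 0\<^sub>m (d ^ length (c # w)) (d ^ length (c # w))"
      using Rc \<rho> by (intro left_mult_zero_mat) simp
    moreover have "1 \<le> G ^ length (c # w)" using G1 by (rule one_le_power)
    ultimately show ?thesis using 0
      by (intro exI[of _ 0]) (simp flip: G_def)
  next
    case (Suc s)
    obtain r where r: "mtrace (near d P w (Suc s) * kron_list \<rho>s) = of_real r" "r \<le> 1"
        "1 - r \<le> G ^ length w / \<mu> ^ Suc s"
      using Cons(3) unfolding G_def by blast
    obtain r' where r': "mtrace (near d P w s * kron_list \<rho>s) = of_real r'" "r' \<le> 1"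
        "1 - r' \<le> G ^ length w / \<mu> ^ s"
      using Cons(3) unfolding G_def by blast
    define p where "p = prob_outcome d P \<rho> c"
    have p: "mtrace (branch d P c * \<rho>) = of_real p" "mtrace (branch d P (\<not> c) * \<rho>) = of_real (1 - p)"
       "0 \<le> p" "p \<le> 1" "1 - \<epsilon> \<le> p"
      using prob_outcome_eq[OF P \<rho>(1), of c] prob_outcome_eq[OF P \<rho>(1), of "\<not> c"]
        prob_outcome_complement[OF P \<rho>(1), of c] Cons(1)
      unfolding p_def by auto
    have "near d P (c # w) t * kron_list (\<rho> # \<rho>s) =
        kron (branch d P c * \<rho>) (near d P w (Suc s) * kron_list \<rho>s)
        + kron (branch d P (\<not> c) * \<rho>) (near d P w s * kron_list \<rho>s)"
      unfolding Suc near.simps kron_list.simps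
        kron_mult[OF bc \<rho>(2) near_carrier[OF P] Rc, symmetric]
      using near_carrier[OF P, of w s] near_carrier[OF P, of w "Suc s"] bc[of c] bc[of "\<not> c"] Rc \<rho>
      by (intro add_mult_distrib_mat[of _ "d * d ^ length w" "d * d ^ length w" _ _ "d * d ^ length w"] kron_carrier) 
    then have "mtrace (near d P (c # w) t * kron_list (\<rho> # \<rho>s)) =
        mtrace (kron (branch d P c * \<rho>) (near d P w (Suc s) * kron_list \<rho>s))
        + mtrace (kron (branch d P (\<not> c) * \<rho>) (near d P w s * kron_list \<rho>s))"
      using near_carrier[OF P, of w s] near_carrier[OF P, of w "Suc s"] bc[of c] bc[of "\<not> c"] Rc \<rho>
      by (simp only:) (intro mtrace_add[of _ "d * d ^ length w"] kron_carrier mult_carrier_mat)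
    also have "\<dots> = of_real p * of_real r + of_real (1 - p) * of_real r'"
      unfolding mtrace_kron[OF mult_carrier_mat[OF bc \<rho>(2)] mult_carrier_mat[OF near_carrier[OF P] Rc]] p r r' ..
    also have "\<dots> = of_real (p * r + (1 - p) * r')" by simp
    finally have tr: "mtrace (near d P (c # w) t * kron_list (\<rho> # \<rho>s)) = of_real (p * r + (1 - p) * r')" .
    have "p * r + (1 - p) * r' \<le> 1"
      using p r(2) r'(2) convex_bound_le[of r 1 r' p "1 - p"] by simp
    moreover have "1 - (p * r + (1 - p) * r') \<le> G ^ length (c # w) / \<mu> ^ t"
    proof -
      have \<mu>: "0 < \<mu>" using assms by simp
      have "1 - (p * r + (1 - p) * r') = p * (1 - r) + (1 - p) * (1 - r')"
        by (simp add: algebra_simps)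
      also have "\<dots> \<le> p * (G ^ length w / \<mu> ^ Suc s) + (1 - p) * (G ^ length w / \<mu> ^ s)"
        using p r r' by (intro add_mono mult_left_mono) auto
      \<comment> \<open>A wrong first outcome lowers the remaining threshold by one, which is worth
        a factor \<open>\<mu>\<close>; the resulting factor increases with the error probability
        \<open>1 - p\<close>, which is at most \<open>\<epsilon>\<close>.\<close>
      also have "\<dots> = (p + (1 - p) * \<mu>) * (G ^ length w / \<mu> ^ Suc s)"
        using \<mu> by (simp add: field_simps)
      also have "\<dots> \<le> G * (G ^ length w / \<mu> ^ Suc s)"
      proof (rule mult_right_mono)
        have "(1 - p) * (\<mu> - 1) \<le> \<epsilon> * (\<mu> - 1)"
          using p assms by (intro mult_right_mono) auto
        then show "p + (1 - p) * \<mu> \<le> G" by (simp add: G_def algebra_simps)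
      qed (use G1 \<mu> in auto)
      finally show ?thesis using Suc by simp
    qed
    ultimately show ?thesis using tr unfolding G_def by blast
  qed
qed

section \<open>Sequential decoding\<close>

text \<open>Sequential decoding: entry \<open>i\<close> of \<open>W\<close> guesses the bits at
  position \<open>i\<close> of all \<open>k\<close> code words. The head of the list stands
  rightmost and is measured first; lists of unequal length are cut to the shorter one.\<close>

fun chain :: "nat \<Rightarrow> nat \<Rightarrow> nat \<Rightarrow> complex mat list \<Rightarrow> bool list list \<Rightarrow> complex mat" where
  "chain d k t (P # Ps) (w # W) = chain d k t Ps W * near d P w t"
| "chain d k t _ _ = 1\<^sub>m (d ^ k)"

lemma chain_carrier:
  assumes "\<forall>P\<in>set Ps. projector d P" "set W \<subseteq> words k"
  shows "chain d k t Ps W \<in> carrier_mat (d ^ k) (d ^ k)"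
  using assms
proof (induction d k t Ps W rule: chain.induct)
  case (1 d k t P Ps w W)
  then show ?case using near_carrier[of d P w t] by (auto intro!: mult_carrier_mat)
qed auto

text \<open>Each position multiplies the total by the ball volume: the induction hypothesis takes
  the projected matrix for \<open>X\<close>, and \<open>near_sum_fnorm\<close> sums over the first
  word.\<close>

lemma chain_sum_fnorm:
  assumes "\<forall>P\<in>set Ps. projector d P" and "X \<in> carrier_mat (d ^ k) m"
  shows "(\<Sum>W\<in>{W. set W \<subseteq> words k \<and> length W = length Ps}. (fnorm (chain d k t Ps W * X))\<^sup>2)
    = real (near_count k t) ^ length Ps * (fnorm X)\<^sup>2"
  using assms
proof (induction Ps arbitrary: X)
  case Nil
  have "{W. set W \<subseteq> words k \<and> length W = 0} = {[]}" by auto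
  then show ?case using Nil by simp
next
  case (Cons P Ps)
  have P: "projector d P" and Ps: "\<forall>P\<in>set Ps. projector d P" using Cons.prems by auto
  let ?A = "{W. set W \<subseteq> words k \<and> length W = length Ps}"
  have "(\<Sum>W\<in>{W. set W \<subseteq> words k \<and> length W = length (P # Ps)}. (fnorm (chain d k t (P # Ps) W * X))\<^sup>2)
      = (\<Sum>w\<in>words k. \<Sum>W\<in>?A. (fnorm (chain d k t Ps W * (near d P w t * X)))\<^sup>2)"
    unfolding length_Cons sum_lists_Suc
  proof (intro sum.cong refl)
    fix w W assume "w \<in> words k" "W \<in> ?A"
    then have "chain d k t (P # Ps) (w # W) * X = chain d k t Ps W * (near d P w t * X)"
      using chain_carrier[OF Ps, of W k t] near_carrier[OF P, of w t] Cons.prems(2) by (auto simp: mult_assoc_dim)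
    then show "(fnorm (chain d k t (P # Ps) (w # W) * X))\<^sup>2 = (fnorm (chain d k t Ps W * (near d P w t * X)))\<^sup>2"
      by simp
  qed
  also have "\<dots> = (\<Sum>w\<in>words k. real (near_count k t) ^ length Ps * (fnorm (near d P w t * X))\<^sup>2)"
  proof (rule sum.cong[OF refl])
    fix w assume "w \<in> words k"
    then have "near d P w t * X \<in> carrier_mat (d ^ k) m"
      using near_carrier[OF P, of w t] Cons.prems(2) by auto
    then show "(\<Sum>W\<in>?A. (fnorm (chain d k t Ps W * (near d P w t * X)))\<^sup>2)
        = real (near_count k t) ^ length Ps * (fnorm (near d P w t * X))\<^sup>2"
      by (rule Cons.IH[OF Ps])
  qed
  also have "\<dots> = real (near_count k t) ^ length Ps * (real (near_count k t) * (fnorm X)\<^sup>2)"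
    unfolding sum_distrib_left[symmetric] near_sum_fnorm[OF P Cons.prems(2)] ..
  finally show ?case by simp
qed

lemma chain_fnorm_le:
  assumes "\<forall>P\<in>set Ps. projector d P" "set W \<subseteq> words k" "X \<in> carrier_mat (d ^ k) m"
  shows "fnorm (chain d k t Ps W * X) \<le> fnorm X"
  using assms
proof (induction d k t Ps W arbitrary: X rule: chain.induct)
  case (1 d k t P Ps w W)
  have P: "projector d P" and Ps: "\<forall>P\<in>set Ps. projector d P" and W: "set W \<subseteq> words k" and w: "length w = k"
    using 1 by auto
  have N: "projector (d ^ k) (near d P w t)" using near_projector[OF P, of w t] w by simp
  have "chain d k t (P # Ps) (w # W) * X = chain d k t Ps W * (near d P w t * X)"
    using chain_carrier[OF Ps W, of t] projector_carrier[OF N] 1(4) by (auto simp: mult_assoc_dim)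
  also have "fnorm \<dots> \<le> fnorm (near d P w t * X)"
    using 1(1)[OF Ps W] 1(4) projector_carrier[OF N] by auto
  also have "\<dots> \<le> fnorm X"
    by (rule fnorm_projector_le[OF N 1(4)])
  finally show ?case .
qed auto

text \<open>Gentle measurement: replacing each projection in turn by the identity costs at most
  the norm of the discarded component.\<close>

lemma chain_gentle:
  assumes "\<forall>P\<in>set Ps. projector d P" "set W \<subseteq> words k" "X \<in> carrier_mat (d ^ k) m"
    and "list_all2 (\<lambda>P w. fnorm ((1\<^sub>m (d ^ k) - near d P w t) * X) \<le> \<eta>) Ps W"
  shows "fnorm X \<le> fnorm (chain d k t Ps W * X) + real (length Ps) * \<eta>"
  using assms
proof (induction Ps arbitrary: W)
  case Nil
  then show ?case by simp
next
  case (Cons P Ps W')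
  obtain w W where W': "W' = w # W" using Cons.prems(4) by (cases W') auto
  have P: "projector d P" and Ps: "\<forall>P\<in>set Ps. projector d P" and W: "set W \<subseteq> words k" and w: "length w = k"
    and X: "X \<in> carrier_mat (d ^ k) m"
    using Cons.prems W' by auto
  have N: "near d P w t \<in> carrier_mat (d ^ k) (d ^ k)" using near_carrier[OF P, of w t] w by simp
  have C: "chain d k t Ps W \<in> carrier_mat (d ^ k) (d ^ k)" by (rule chain_carrier[OF Ps W])
  let ?Y = "(1\<^sub>m (d ^ k) - near d P w t) * X"
  have Y: "?Y \<in> carrier_mat (d ^ k) m" using N X by auto
  have NX: "near d P w t * X \<in> carrier_mat (d ^ k) m" using N X by auto
  \<comment> \<open>The rest of the chain is a contraction, so the discarded part \<open>?Y\<close>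
    costs at most \<open>\<eta>\<close>. The induction hypothesis is applied to the undisturbed
    \<open>X\<close>, hence the costs just add up.\<close>
  have "X = near d P w t * X + ?Y"
    using N X by (auto simp: minus_mult_dim intro!: eq_matI)
  then have "chain d k t Ps W * X = chain d k t Ps W * (near d P w t * X) + chain d k t Ps W * ?Y"
    using mult_add_distrib_mat[OF C NX Y] by simp
  also have "chain d k t Ps W * (near d P w t * X) = chain d k t (P # Ps) W' * X"
    using C N X unfolding W' by (auto simp: mult_assoc_dim)
  finally have "fnorm (chain d k t Ps W * X) \<le> fnorm (chain d k t (P # Ps) W' * X) + fnorm (chain d k t Ps W * ?Y)"
    using fnorm_triangle[of "chain d k t (P # Ps) W' * X" "d ^ k" m "chain d k t Ps W * ?Y"]
      chain_carrier[OF Cons.prems(1,2), of t] C X Y by auto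
  also have "fnorm (chain d k t Ps W * ?Y) \<le> fnorm ?Y"
    by (rule chain_fnorm_le[OF Ps W Y])
  also have "fnorm ?Y \<le> \<eta>" using Cons.prems(4) W' by simp
  finally show ?case
    using Cons.IH[OF Ps W X] Cons.prems(4) W' by (simp add: algebra_simps)
qed

text \<open>With \<open>T\<close> and \<open>R\<close> the products of the remaining factors and c
  the power of \<open>l\<close> for them, the difference is (l \<tau> - \<rho>) \<otimes> c T +
  \<rho> \<otimes> (c T - R), a sum of products of positive matrices.\<close>

lemma psd_kron_list_diff:
  assumes \<tau>: "density d \<tau>" and "0 \<le> (l :: real)"
    and "\<forall>\<rho>\<in>set \<rho>s. density d \<rho> \<and> psd d (of_real l \<cdot>\<^sub>m \<tau> - \<rho>)"
  shows "psd (d ^ length \<rho>s)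
    (of_real (l ^ length \<rho>s) \<cdot>\<^sub>m kron_list (replicate (length \<rho>s) \<tau>) - kron_list \<rho>s)"
  using assms(3)
proof (induction \<rho>s)
  case Nil
  have "psd 1 (of_real 1 \<cdot>\<^sub>m 1\<^sub>m 1 - 1\<^sub>m 1)"
    by (auto simp: psd_iff intro!: minus_carrier_mat)
  then show ?case by simp
next
  case (Cons \<rho> \<rho>s)
  define T where "T = kron_list (replicate (length \<rho>s) \<tau>)"
  define R where "R = kron_list \<rho>s"
  let ?n = "d ^ length \<rho>s" and ?c = "complex_of_real (l ^ length \<rho>s)"
  have T: "density ?n T" unfolding T_def using kron_list_density[of "replicate (length \<rho>s) \<tau>" d] \<tau> by simp
  have R: "density ?n R" unfolding R_def using kron_list_density[of \<rho>s d] Cons.prems by simp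
  have \<rho>: "density d \<rho>" "psd d (of_real l \<cdot>\<^sub>m \<tau> - \<rho>)" using Cons.prems by auto
  have IH: "psd ?n (?c \<cdot>\<^sub>m T - R)" using Cons unfolding T_def R_def by simp
  have c: "T \<in> carrier_mat ?n ?n" "R \<in> carrier_mat ?n ?n" "\<rho> \<in> carrier_mat d d" "\<tau> \<in> carrier_mat d d"
    using T R \<rho> \<tau> density_carrier by auto
  have "psd (d * ?n) (kron (of_real l \<cdot>\<^sub>m \<tau> - \<rho>) (?c \<cdot>\<^sub>m T) + kron \<rho> (?c \<cdot>\<^sub>m T - R))"
    using T R \<rho> IH assms(2) unfolding density_def
    by (intro psd_add psd_kron psd_smult) auto
  also have "kron (of_real l \<cdot>\<^sub>m \<tau> - \<rho>) (?c \<cdot>\<^sub>m T) + kron \<rho> (?c \<cdot>\<^sub>m T - R)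
     = of_real (l ^ Suc (length \<rho>s)) \<cdot>\<^sub>m kron \<tau> T - kron \<rho> R"
    using c by (intro eq_matI) (auto simp: kron_index div_mod_less algebra_simps)
  finally show ?case by (simp add: T_def R_def)
qed

text \<open>Conjugation by \<open>L\<close> preserves positivity, and a positive matrix has
  nonnegative trace. This passes from a state that depends on the code words to the common
  dominating one.\<close>

lemma fnorm_mult_psd_le:
  assumes "psd d (of_real c \<cdot>\<^sub>m (G * mat_adjoint G) - C * mat_adjoint C)"
    and "G \<in> carrier_mat d d" "C \<in> carrier_mat d d" "L \<in> carrier_mat d d"
  shows "(fnorm (L * C))\<^sup>2 \<le> c * (fnorm (L * G))\<^sup>2"
proof -
  have eq: "mat_adjoint (L * X) = mat_adjoint X * mat_adjoint L" if "X \<in> carrier_mat d d" for X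
    using that assms by (rule_tac adjoint_mult) auto
  have "L * (of_real c \<cdot>\<^sub>m (G * mat_adjoint G) - C * mat_adjoint C) * mat_adjoint L
     = of_real c \<cdot>\<^sub>m ((L * G) * mat_adjoint (L * G)) - (L * C) * mat_adjoint (L * C)"
    unfolding eq[OF assms(2)] eq[OF assms(3)]
    using assms(2-) by (auto simp: mult_minus_dim minus_mult_dim mult_assoc_dim
        mult_smult_distrib[of _ d d _ d] mult_smult_assoc_mat[of _ d d _ d])
  then have "0 \<le> mtrace (of_real c \<cdot>\<^sub>m ((L * G) * mat_adjoint (L * G)) - (L * C) * mat_adjoint (L * C))"
    using psd_mtrace_nonneg[OF psd_congruence[OF assms(1,4)]] by simp
  also have "\<dots> = of_real c * complex_of_real ((fnorm (L * G))\<^sup>2) - complex_of_real ((fnorm (L * C))\<^sup>2)"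
    unfolding fnorm_square using assms(2-)
    by (subst mtrace_minus[of _ d]) (auto intro!: mtrace_smult[of _ d])
  also have "\<dots> = complex_of_real (c * (fnorm (L * G))\<^sup>2 - (fnorm (L * C))\<^sup>2)" by simp
  finally show ?thesis by (simp only: less_eq_complex_def) simp
qed

text \<open>Two estimates meet. The correct guess survives its own chain up to the gentle
  measurement loss; replacing the state of the code words by the \<open>k\<close>-fold power of
  \<open>\<tau>\<close> costs \<open>l ^ k\<close>; and for this fixed state the total over all
  \<open>(2 ^ k) ^ N\<close> guesses is \<open>near_count k t ^ N\<close>.\<close>

lemma random_access_copies:
  assumes Ps: "length Ps = N" "\<forall>P\<in>set Ps. projector d P"
    and \<tau>: "density d \<tau>" and l: "0 \<le> (l :: real)"
    and \<rho>: "\<And>z. length z = N \<Longrightarrow> density d (\<rho> z) \<and> psd d (of_real l \<cdot>\<^sub>m \<tau> - \<rho> z)"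
    and dec: "\<And>z i. length z = N \<Longrightarrow> i < N \<Longrightarrow> 1 - \<epsilon> \<le> prob_outcome d (Ps ! i) (\<rho> z) (z ! i)"
    and \<epsilon>: "0 \<le> \<epsilon>" and \<mu>: "1 \<le> \<mu>"
    and small: "real N * sqrt ((1 - \<epsilon> + \<epsilon> * \<mu>) ^ k / \<mu> ^ t) \<le> 1"
  shows "(2 ^ k) ^ N * (1 - real N * sqrt ((1 - \<epsilon> + \<epsilon> * \<mu>) ^ k / \<mu> ^ t))\<^sup>2
    \<le> l ^ k * real (near_count k t) ^ N"
proof -
  define e where "e = (1 - \<epsilon> + \<epsilon> * \<mu>) ^ k / \<mu> ^ t"
  define S where "S = {W. set W \<subseteq> words k \<and> length W = N}"
  define T where "T = kron_list (replicate k \<tau>)"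
  have T: "density (d ^ k) T" unfolding T_def using kron_list_density[of "replicate k \<tau>" d] \<tau> by simp
  obtain G where G: "G \<in> carrier_mat (d ^ k) (d ^ k)" "T = G * mat_adjoint G"
    using T psd_factor unfolding density_def by metis
  have fG: "(fnorm G)\<^sup>2 = 1"
    using fnorm_square[of G] T unfolding G(2) density_def
    by (metis of_real_eq_1_iff)
  have main: "(1 - real N * sqrt e)\<^sup>2 \<le> l ^ k * (fnorm (chain d k t Ps W * G))\<^sup>2" if W: "W \<in> S" for W
  proof -
    \<comment> \<open>\<open>W\<close> is a table of \<open>N\<close> rows and \<open>k\<close>
      columns: row \<open>i\<close> is the guess for position \<open>i\<close>, column
      \<open>j\<close> is the message encoded in copy \<open>j\<close>.\<close>
    define \<rho>s where "\<rho>s = map (\<lambda>j. \<rho> (map (\<lambda>w. w ! j) W)) [0..<k]"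
    have len: "length \<rho>s = k" by (simp add: \<rho>s_def)
    have \<rho>s: "\<forall>\<rho>\<in>set \<rho>s. density d \<rho> \<and> psd d (of_real l \<cdot>\<^sub>m \<tau> - \<rho>)"
      using W \<rho> by (auto simp: \<rho>s_def S_def)
    have R: "density (d ^ k) (kron_list \<rho>s)" using kron_list_density[of \<rho>s d] \<rho>s len by auto
    obtain C where C: "C \<in> carrier_mat (d ^ k) (d ^ k)" "kron_list \<rho>s = C * mat_adjoint C"
      using R psd_factor unfolding density_def by metis
    have fC: "(fnorm C)\<^sup>2 = 1"
      using fnorm_square[of C] R unfolding C(2) density_def by (metis of_real_eq_1_iff)
    then have fC1: "fnorm C = 1"
      using fnorm_nonneg[of C] by (metis power2_eq_1_iff neg_0_le_iff_le not_one_le_zero)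
    have W': "set W \<subseteq> words k" using W by (simp add: S_def)
    \<comment> \<open>Each test, applied to the undisturbed state, discards a component of squared
      norm \<open>1 - r\<close> with \<open>r\<close> from the Chernoff bound.\<close>
    have "list_all2 (\<lambda>P w. fnorm ((1\<^sub>m (d ^ k) - near d P w t) * C) \<le> sqrt e) Ps W"
    proof (rule list_all2_all_nthI)
      show "length Ps = length W" using Ps W by (simp add: S_def)
    next
      fix i assume i: "i < length Ps"
      let ?P = "Ps ! i" and ?w = "W ! i"
      have P: "projector d ?P" using Ps i by auto
      have "?w \<in> set W" using W i Ps(1) by (intro nth_mem) (simp add: S_def)
      then have w: "length ?w = k" using W' by auto
      have N: "projector (d ^ k) (near d ?P ?w t)" using near_projector[OF P, of ?w t] w by simp
      have "list_all2 (\<lambda>c \<rho>. density d \<rho> \<and> 1 - \<epsilon> \<le> prob_outcome d ?P \<rho> c) ?w \<rho>s"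
      proof (rule list_all2_all_nthI)
        show "length ?w = length \<rho>s" using w len by simp
      next
        fix j assume j: "j < length ?w"
        have z: "length (map (\<lambda>w. w ! j) W) = N" using W by (simp add: S_def)
        have "map (\<lambda>w. w ! j) W ! i = ?w ! j" using i Ps W by (auto simp: S_def)
        then show "density d (\<rho>s ! j) \<and> 1 - \<epsilon> \<le> prob_outcome d ?P (\<rho>s ! j) (?w ! j)"
          using \<rho>[OF z] dec[OF z, of i] i j w Ps by (simp add: \<rho>s_def)
      qed
      from near_success[OF P \<epsilon> \<mu> this, of t] obtain r where
        r: "mtrace (near d ?P ?w t * kron_list \<rho>s) = of_real r" "1 - r \<le> e"
        unfolding w e_def by blast
      have "complex_of_real ((fnorm (near d ?P ?w t * C))\<^sup>2) = of_real r"
        using fnorm_projector_square[OF N C(1)] r(1) unfolding C(2) by simp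
      then have "(fnorm (near d ?P ?w t * C))\<^sup>2 = r" by (simp only: of_real_eq_iff)
      then have "(fnorm ((1\<^sub>m (d ^ k) - near d ?P ?w t) * C))\<^sup>2 = 1 - r"
        using fnorm_projector_pythagoras[OF N C(1)] fC by simp
      then show "fnorm ((1\<^sub>m (d ^ k) - near d ?P ?w t) * C) \<le> sqrt e"
        using r(2) by (simp add: real_le_rsqrt)
    qed
    from chain_gentle[OF Ps(2) W' C(1) this]
    have "1 - real N * sqrt e \<le> fnorm (chain d k t Ps W * C)" using fC1 Ps(1) by simp
    \<comment> \<open>By \<open>small\<close> the left side is nonnegative, so squaring is
      monotone.\<close>
    then have "(1 - real N * sqrt e)\<^sup>2 \<le> (fnorm (chain d k t Ps W * C))\<^sup>2"
      using small unfolding e_def by (intro power_mono) auto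
    also have "\<dots> \<le> l ^ k * (fnorm (chain d k t Ps W * G))\<^sup>2"
      using psd_kron_list_diff[OF \<tau> l \<rho>s] G C chain_carrier[OF Ps(2) W'] unfolding len T_def[symmetric]
      by (intro fnorm_mult_psd_le[of "d ^ k"]) auto
    finally show ?thesis .
  qed
  have fin: "finite (words k)" using finite_lists_length_eq[of "UNIV :: bool set" k] by simp
  have "card (words k) = 2 ^ k" using card_lists_length_eq[of "UNIV :: bool set" k] by simp
  then have cS: "card S = (2 ^ k) ^ N"
    unfolding S_def using card_lists_length_eq[OF fin, of N] by simp
  have "(2 ^ k) ^ N * (1 - real N * sqrt e)\<^sup>2 = (\<Sum>W\<in>S. (1 - real N * sqrt e)\<^sup>2)"
    by (simp add: cS)
  also have "\<dots> \<le> (\<Sum>W\<in>S. l ^ k * (fnorm (chain d k t Ps W * G))\<^sup>2)"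
    by (intro sum_mono main)
  also have "\<dots> = l ^ k * (real (near_count k t) ^ N * (fnorm G)\<^sup>2)"
    unfolding S_def sum_distrib_left[symmetric] using chain_sum_fnorm[OF Ps(2) G(1), of t] Ps(1) by simp
  finally show ?thesis by (simp add: fG e_def)
qed

section \<open>Random access codes\<close>

text \<open>\<open>\<mu>\<close> is the optimal tilt, at which the logarithm of the Chernoff base is
  minus the relative entropy of a coin of bias \<open>r\<close> with respect to one of bias
  \<open>\<epsilon>\<close>. It is negative because \<open>ln x < x - 1\<close> for positive x
  different from 1.\<close>

lemma chernoff_base_less_one:
  fixes \<epsilon> r \<mu> :: real
  assumes "0 < \<epsilon>" "\<epsilon> < r" "r < 1/2" and \<mu>: "\<mu> = r * (1 - \<epsilon>) / (\<epsilon> * (1 - r))"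
  shows "1 < \<mu>" "(1 - \<epsilon> + \<epsilon> * \<mu>) / \<mu> powr r < 1"
proof -
  have "\<epsilon> * (1 - r) < r * (1 - \<epsilon>)" using assms by (simp add: algebra_simps)
  then show \<mu>1: "1 < \<mu>" unfolding \<mu> using assms by simp
  have base: "1 - \<epsilon> + \<epsilon> * \<mu> = (1 - \<epsilon>) / (1 - r)"
    unfolding \<mu> using assms by (simp add: field_simps)
  have pos: "0 < (1 - \<epsilon> + \<epsilon> * \<mu>) / \<mu> powr r"
    unfolding base using assms(1-3) \<mu>1 by simp
  have ln\<mu>: "ln \<mu> = ln r + ln (1 - \<epsilon>) - (ln \<epsilon> + ln (1 - r))"
    unfolding \<mu> using assms(1-3) by (simp add: ln_div ln_mult)
  have "ln (\<epsilon> / r) < \<epsilon> / r - 1"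
    using assms ln_le_minus_one[of "\<epsilon> / r"] ln_eq_minus_one[of "\<epsilon> / r"] by fastforce
  then have 1: "r * ln (\<epsilon> / r) < r * (\<epsilon> / r - 1)" using assms by simp
  have 2: "(1 - r) * ln ((1 - \<epsilon>) / (1 - r)) \<le> (1 - r) * ((1 - \<epsilon>) / (1 - r) - 1)"
    using assms by (intro mult_left_mono ln_le_minus_one) auto
  have "ln ((1 - \<epsilon> + \<epsilon> * \<mu>) / \<mu> powr r) = ln ((1 - \<epsilon>) / (1 - r)) - r * ln \<mu>"
    unfolding base using assms(1-3) \<mu>1 by (simp add: ln_div ln_mult ln_powr)
  also have "\<dots> = r * ln (\<epsilon> / r) + (1 - r) * ln ((1 - \<epsilon>) / (1 - r))"
    unfolding ln\<mu> using assms(1-3) by (simp add: ln_div algebra_simps)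
  also have "\<dots> < r * (\<epsilon> / r - 1) + (1 - r) * ((1 - \<epsilon>) / (1 - r) - 1)"
    using 1 2 by linarith
  also have "(1 - r) * ((1 - \<epsilon>) / (1 - r) - 1) = r - \<epsilon>"
    using assms(1-3) by (simp only: right_diff_distrib[of "1 - r"]) simp
  also have "r * (\<epsilon> / r - 1) + (r - \<epsilon>) = 0"
    using assms(1-3) by (simp add: right_diff_distrib')
  finally show "(1 - \<epsilon> + \<epsilon> * \<mu>) / \<mu> powr r < 1"
    by (simp only: ln_less_zero_iff[OF pos])
qed

text \<open>At \<open>\<theta> = r / (1 - r)\<close>, the minimiser of
  \<open>(1 + \<theta>) / \<theta> powr r\<close>, the exponent in the bound for the ball volume is
  the entropy.\<close>

lemma Hbin_log:
  assumes "0 < r" "r < 1"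
  shows "log 2 (1 + r / (1 - r)) - r * log 2 (r / (1 - r)) = Hbin r"
proof -
  have "1 + r / (1 - r) = 1 / (1 - r)" using assms by (simp add: field_simps)
  then show ?thesis using assms by (simp add: Hbin_def log_divide algebra_simps)
qed

text \<open>For fixed \<open>r > \<epsilon>\<close> the loss decays exponentially in
  \<open>k\<close> while \<open>N\<close> stays fixed; taking logarithms in
  \<open>random_access_copies\<close> and dividing by \<open>k\<close> leaves an error of order
  1/k.\<close>

lemma random_access_bound_aux:
  assumes Ps: "length Ps = N" "\<forall>P\<in>set Ps. projector d P"
    and \<tau>: "density d \<tau>" and l: "0 < (l :: real)"
    and \<rho>: "\<And>z. length z = N \<Longrightarrow> density d (\<rho> z) \<and> psd d (of_real l \<cdot>\<^sub>m \<tau> - \<rho> z)"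
    and dec: "\<And>z i. length z = N \<Longrightarrow> i < N \<Longrightarrow> 1 - \<epsilon> \<le> prob_outcome d (Ps ! i) (\<rho> z) (z ! i)"
    and \<epsilon>: "0 < \<epsilon>" "\<epsilon> < r" "r < 1/2"
  shows "(1 - Hbin r) * real N \<le> log 2 l"
proof -
  define \<mu> where "\<mu> = r * (1 - \<epsilon>) / (\<epsilon> * (1 - r))"
  define q where "q = (1 - \<epsilon> + \<epsilon> * \<mu>) / \<mu> powr r"
  define \<theta> where "\<theta> = r / (1 - r)"
  have \<mu>1: "1 < \<mu>" and q1: "q < 1"
    using chernoff_base_less_one[OF \<epsilon> \<mu>_def] unfolding q_def by auto
  have "0 < 1 - \<epsilon> + \<epsilon> * \<mu>" using \<epsilon> \<mu>1 by (intro add_pos_nonneg) auto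
  then have q0: "0 < q" unfolding q_def using \<mu>1 by auto
  have \<theta>: "0 < \<theta>" "\<theta> < 1" using \<epsilon> by (auto simp: \<theta>_def)
  have H: "log 2 (1 + \<theta>) - r * log 2 \<theta> = Hbin r"
    unfolding \<theta>_def using \<epsilon> by (intro Hbin_log) auto
  \<comment> \<open>Rounding up keeps the Chernoff exponent, which needs \<open>t k\<close> to be at
    least \<open>r * real k\<close>; the volume bound then loses at most one factor
    \<open>1 / \<theta>\<close> per position.\<close>
  define t where "t k = nat \<lceil>r * real k\<rceil>" for k :: nat
  have t: "r * real k \<le> real (t k)" "real (t k) \<le> r * real k + 1" for k
    using \<epsilon> unfolding t_def by (auto simp: real_nat_ceiling_ge)
  define e where "e k = (1 - \<epsilon> + \<epsilon> * \<mu>) ^ k / \<mu> ^ t k" for k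
  have e: "e k \<le> q ^ k" for k
  proof -
    have "(\<mu> powr r) ^ k = \<mu> powr (r * real k)" using \<mu>1 by (simp add: powr_powr flip: powr_realpow)
    also have "\<dots> \<le> \<mu> powr (real (t k))" using t \<mu>1 by (intro powr_mono) auto
    also have "\<dots> = \<mu> ^ t k" using \<mu>1 by (simp add: powr_realpow)
    finally have "e k \<le> (1 - \<epsilon> + \<epsilon> * \<mu>) ^ k / (\<mu> powr r) ^ k"
      unfolding e_def using \<open>0 < 1 - \<epsilon> + \<epsilon> * \<mu>\<close> \<mu>1 by (intro divide_left_mono) auto
    then show ?thesis by (simp add: q_def power_divide)
  qed
  have e0: "0 \<le> e k" for k unfolding e_def using \<open>0 < 1 - \<epsilon> + \<epsilon> * \<mu>\<close> \<mu>1 by auto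
  have "(\<lambda>k. real N * sqrt (q ^ k)) \<longlonglongrightarrow> real N * sqrt 0"
    using q0 q1 by (intro tendsto_intros LIMSEQ_power_zero) auto
  \<comment> \<open>Below 1/2 the squared success term is at least 1/4, which accounts for the
    constant 2 in \<open>est\<close>.\<close>
  then have ev: "eventually (\<lambda>k. real N * sqrt (q ^ k) < 1/2) sequentially"
    by (rule order_tendstoD) simp
  have est: "(1 - Hbin r) * real N - log 2 l \<le> (2 - real N * log 2 \<theta>) / real k"
    if k: "k > 0" "real N * sqrt (q ^ k) < 1/2" for k
  proof -
    have Ne: "real N * sqrt (e k) \<le> 1/2"
    proof -
      have "real N * sqrt (e k) \<le> real N * sqrt (q ^ k)" using e by (intro mult_left_mono) auto
      then show ?thesis using k by simp
    qed
    have bound: "(2 ^ k) ^ N * (1 - real N * sqrt (e k))\<^sup>2 \<le> l ^ k * real (near_count k (t k)) ^ N"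
      unfolding e_def
      by (rule random_access_copies[OF Ps \<tau> _ \<rho> dec]) (use l \<epsilon> \<mu>1 Ne in \<open>auto simp: e_def\<close>)
    have "(1/2)\<^sup>2 \<le> (1 - real N * sqrt (e k))\<^sup>2" using Ne by (intro power_mono) auto
    then have "(2 ^ k) ^ N * (1/4) \<le> (2 ^ k) ^ N * (1 - real N * sqrt (e k))\<^sup>2"
      by (intro mult_left_mono) (auto simp: power2_eq_square)
    also note bound
    also have "l ^ k * real (near_count k (t k)) ^ N \<le> l ^ k * ((1 + \<theta>) ^ k / \<theta> ^ t k) ^ N"
      using near_count_bound[of \<theta> k "t k"] \<theta> l
      by (intro mult_left_mono power_mono) (auto simp: pos_le_divide_eq)
    finally have "log 2 ((2 ^ k) ^ N * (1/4)) \<le> log 2 (l ^ k * ((1 + \<theta>) ^ k / \<theta> ^ t k) ^ N)"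
      using \<theta> l by (subst log_le_cancel_iff) auto
    also have "log 2 ((2 ^ k) ^ N * (1/4)) = real N * real k - 2"
    proof -
      have "log 2 (1/4 :: real) = - 2"
        using log_nat_power[of 2 2 2] by (simp add: log_divide)
      moreover have "log 2 ((2 ^ k) ^ N * (1/4 :: real)) = log 2 ((2 ^ k) ^ N) + log 2 (1/4)"
        by (subst log_mult) auto
      ultimately show ?thesis by (simp add: log_nat_power)
    qed
    also have "log 2 (l ^ k * ((1 + \<theta>) ^ k / \<theta> ^ t k) ^ N)
        = real k * log 2 l + real N * (real k * log 2 (1 + \<theta>) - real (t k) * log 2 \<theta>)"
      using \<theta> l by (simp add: log_mult log_nat_power log_divide)
    also have "\<dots> \<le> real k * log 2 l + real N * (real k * log 2 (1 + \<theta>) - (r * real k + 1) * log 2 \<theta>)"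
    proof -
      have "log 2 \<theta> \<le> 0" using \<theta> by (simp add: log_le_zero_cancel_iff)
      then have "(r * real k + 1) * log 2 \<theta> \<le> real (t k) * log 2 \<theta>"
        using t(2) by (rule mult_right_mono_neg[rotated])
      then show ?thesis by (intro add_left_mono mult_left_mono) auto
    qed
    also have "\<dots> = real k * log 2 l + real N * (real k * Hbin r - log 2 \<theta>)"
      unfolding H[symmetric] by (simp add: algebra_simps)
    finally show ?thesis
      using k by (simp add: field_simps)
  qed
  from ev eventually_gt_at_top[of 0] have "eventually (\<lambda>k. (1 - Hbin r) * real N - log 2 l \<le> (2 - real N * log 2 \<theta>) / real k) sequentially"
    by eventually_elim (rule est)
  moreover have "(\<lambda>k. (2 - real N * log 2 \<theta>) / real k) \<longlonglongrightarrow> 0"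
    by (rule lim_const_over_n)
  ultimately have "(1 - Hbin r) * real N - log 2 l \<le> 0"
    by (intro tendsto_lowerbound[where F = sequentially]) auto
  then show ?thesis by simp
qed

text \<open>The auxiliary bound holds for all \<open>r\<close> strictly between
  \<open>\<epsilon>\<close> and 1/2; by continuity of \<open>Hbin\<close>, \<open>r\<close> may tend
  to \<open>\<epsilon>\<close> from the right.\<close>

theorem random_access_bound:
  assumes Ps: "length Ps = N" "\<forall>P\<in>set Ps. projector d P"
    and \<tau>: "density d \<tau>" and l: "0 < (l :: real)"
    and \<rho>: "\<And>z. length z = N \<Longrightarrow> density d (\<rho> z) \<and> psd d (of_real l \<cdot>\<^sub>m \<tau> - \<rho> z)"
    and dec: "\<And>z i. length z = N \<Longrightarrow> i < N \<Longrightarrow> 1 - \<epsilon> \<le> prob_outcome d (Ps ! i) (\<rho> z) (z ! i)"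
    and \<epsilon>: "0 < \<epsilon>" "\<epsilon> < 1/2"
  shows "(1 - Hbin \<epsilon>) * real N \<le> log 2 l"
proof (rule tendsto_upperbound[where F = "at_right \<epsilon>"])
  have "isCont Hbin \<epsilon>"
    unfolding Hbin_def using \<epsilon> by (intro continuous_intros) auto
  then have "(Hbin \<longlongrightarrow> Hbin \<epsilon>) (at_right \<epsilon>)"
    unfolding isCont_def by (rule filterlim_mono) (auto simp: at_le)
  then show "((\<lambda>r. (1 - Hbin r) * real N) \<longlongrightarrow> (1 - Hbin \<epsilon>) * real N) (at_right \<epsilon>)"
    by (intro tendsto_intros)
  have "eventually (\<lambda>r. r \<in> {\<epsilon><..<1/2}) (at_right \<epsilon>)"
    by (rule eventually_at_right_real) (use \<epsilon> in simp)
  then show "eventually (\<lambda>r. (1 - Hbin r) * real N \<le> log 2 l) (at_right \<epsilon>)"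
    by eventually_elim (use random_access_bound_aux[OF Ps \<tau> l \<rho> dec \<epsilon>(1)] in auto)
qed simp

section \<open>Operator domination\<close>

lemma quad_form_gram':
  assumes K: "K \<in> carrier_mat m d"
  shows "quad_form d (mat_adjoint K * K) v = of_real (\<Sum>l<m. (cmod (\<Sum>i<d. K $$ (l, i) * v i))\<^sup>2)"
proof -
  have "quad_form d (mat_adjoint K * K) v
      = of_real (\<Sum>l<m. (cmod (\<Sum>i<d. cnj (v i) * mat_adjoint K $$ (i, l)))\<^sup>2)"
    using quad_form_gram[of "mat_adjoint K" d m v] K by simp
  also have "(\<Sum>i<d. cnj (v i) * mat_adjoint K $$ (i, l)) = cnj (\<Sum>i<d. K $$ (l, i) * v i)" if "l < m" for l
    using that K by (auto simp: mult.commute intro!: sum.cong)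
  then have "(\<Sum>l<m. (cmod (\<Sum>i<d. cnj (v i) * mat_adjoint K $$ (i, l)))\<^sup>2)
      = (\<Sum>l<m. (cmod (\<Sum>i<d. K $$ (l, i) * v i))\<^sup>2)"
    by (intro sum.cong refl) (metis complex_mod_cnj lessThan_iff)
  finally show ?thesis .
qed

lemma foldr_add_carrier:
  "(\<And>K. K \<in> set Ks \<Longrightarrow> f K \<in> carrier_mat d d) \<Longrightarrow>
    foldr (\<lambda>K S. f K + S) Ks (0\<^sub>m d d) \<in> carrier_mat d d"
  by (induction Ks) auto

lemma quad_form_foldr:
  assumes "\<And>K. K \<in> set Ks \<Longrightarrow> f K \<in> carrier_mat d d"
  shows "quad_form d (foldr (\<lambda>K S. f K + S) Ks (0\<^sub>m d d)) v = (\<Sum>K\<leftarrow>Ks. quad_form d (f K) v)"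
  using assms
proof (induction Ks)
  case Nil
  then show ?case by (simp add: quad_form_def)
next
  case (Cons K Ks)
  then show ?case using foldr_add_carrier[of Ks f d] by (simp add: quad_form_add)
qed

lemma complex_Cauchy_Schwarz:
  fixes z :: "'i \<Rightarrow> complex"
  shows "(cmod (\<Sum>i\<in>A. z i * w i))\<^sup>2 \<le> (\<Sum>i\<in>A. (cmod (z i))\<^sup>2) * (\<Sum>i\<in>A. (cmod (w i))\<^sup>2)"
proof -
  have "cmod (\<Sum>i\<in>A. z i * w i) \<le> (\<Sum>i\<in>A. \<bar>cmod (z i)\<bar> * \<bar>cmod (w i)\<bar>)"
    by (rule order.trans[OF norm_sum]) (simp add: norm_mult)
  also have "\<dots> \<le> L2_set (\<lambda>i. cmod (z i)) A * L2_set (\<lambda>i. cmod (w i)) A"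
    by (rule L2_set_mult_ineq)
  finally have "(cmod (\<Sum>i\<in>A. z i * w i))\<^sup>2 \<le> (L2_set (\<lambda>i. cmod (z i)) A * L2_set (\<lambda>i. cmod (w i)) A)\<^sup>2"
    by (intro power_mono) auto
  then show ?thesis by (simp add: L2_set_def power_mult_distrib sum_nonneg)
qed

lemma density_maximally_mixed:
  assumes "d > 0"
  shows "density d (of_real (1 / real d) \<cdot>\<^sub>m 1\<^sub>m d)"
  using assms psd_smult[OF psd_one[of d], of "1 / real d"] by (simp add: density_def mtrace_smult[of _ d])

text \<open>By Cauchy-Schwarz the form of \<open>\<rho>\<close> at \<open>v\<close> is at most the
  trace times the squared norm of \<open>v\<close>. Hence every state on \<open>q\<close> qubits is
  below \<open>2 ^ q\<close> times the maximally mixed one.\<close>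

lemma density_le_one:
  assumes "density d \<rho>"
  shows "psd d (1\<^sub>m d - \<rho>)"
proof -
  obtain C where C: "C \<in> carrier_mat d d" "\<rho> = C * mat_adjoint C"
    using assms psd_factor unfolding density_def by metis
  have "complex_of_real (\<Sum>l<d. \<Sum>i<d. (cmod (C $$ (i, l)))\<^sup>2) = mtrace \<rho>"
    unfolding C(2) using C(1)
    by (subst sum.swap) (simp add: mtrace_def mult_index_sum complex_norm_square del: index_mult_mat(1) of_real_power)
  then have tr: "(\<Sum>l<d. \<Sum>i<d. (cmod (C $$ (i, l)))\<^sup>2) = 1"
    using assms unfolding density_def by (metis of_real_eq_1_iff)
  have "0 \<le> quad_form d (1\<^sub>m d - \<rho>) v" for v
  proof -
    have "(\<Sum>l<d. (cmod (\<Sum>i<d. cnj (v i) * C $$ (i, l)))\<^sup>2)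
        \<le> (\<Sum>l<d. (\<Sum>i<d. (cmod (cnj (v i)))\<^sup>2) * (\<Sum>i<d. (cmod (C $$ (i, l)))\<^sup>2))"
      by (intro sum_mono complex_Cauchy_Schwarz)
    also have "\<dots> = (\<Sum>i<d. (cmod (v i))\<^sup>2)"
      by (simp add: sum_distrib_left[symmetric] tr)
    finally show ?thesis
      using density_carrier[OF assms] quad_form_gram[OF C(1), of v] unfolding C(2)
      by (simp add: quad_form_minus quad_form_one less_eq_complex_def)
  qed
  then show ?thesis using density_carrier[OF assms] by (auto simp: psd_iff_quad_form minus_carrier_mat)
qed

section \<open>Bob's reduced state and Alice's channel\<close>

definition ptrace :: "nat \<Rightarrow> nat \<Rightarrow> complex mat \<Rightarrow> complex mat" where
  "ptrace dA dB \<psi> = mat dB dB (\<lambda>(i, j). \<Sum>a<dA. \<psi> $$ (a * dB + i, a * dB + j))"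

lemma ptrace_carrier [simp]: "ptrace dA dB \<psi> \<in> carrier_mat dB dB"
  by (simp add: ptrace_def)

lemma quad_form_ptrace_gram:
  assumes C: "C \<in> carrier_mat (dA * dB) e"
  shows "quad_form dB (ptrace dA dB (C * mat_adjoint C)) v
    = of_real (\<Sum>l<e. \<Sum>a<dA. (cmod (\<Sum>i<dB. cnj (v i) * C $$ (a * dB + i, l)))\<^sup>2)"
proof -
  \<comment> \<open>\<open>D a\<close> consists of the rows of \<open>C\<close> with Alice's index
    \<open>a\<close>; the partial trace is the sum of the Gram matrices of these blocks.\<close>
  define D where "D a = mat dB e (\<lambda>(i, l). C $$ (a * dB + i, l))" for a
  have D: "D a \<in> carrier_mat dB e" for a by (simp add: D_def)
  have "ptrace dA dB (C * mat_adjoint C) $$ (i, j) = (\<Sum>a<dA. (D a * mat_adjoint (D a)) $$ (i, j))"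
    if "i < dB" "j < dB" for i j
    using that C mult_add_less[of _ dA _ dB]
    by (auto simp: ptrace_def mult_index_sum D_def simp del: index_mult_mat(1) intro!: sum.cong)
  then have "quad_form dB (ptrace dA dB (C * mat_adjoint C)) v
      = (\<Sum>i<dB. \<Sum>j<dB. \<Sum>a<dA. cnj (v i) * (D a * mat_adjoint (D a)) $$ (i, j) * v j)"
    unfolding quad_form_def by (intro sum.cong refl) (simp add: sum_distrib_left sum_distrib_right del: index_mult_mat(1))
  also have "\<dots> = (\<Sum>i<dB. \<Sum>a<dA. \<Sum>j<dB. cnj (v i) * (D a * mat_adjoint (D a)) $$ (i, j) * v j)"
    by (intro sum.cong refl sum.swap)
  also have "\<dots> = (\<Sum>a<dA. quad_form dB (D a * mat_adjoint (D a)) v)"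
    unfolding quad_form_def by (rule sum.swap)
  also have "\<dots> = (\<Sum>a<dA. of_real (\<Sum>l<e. (cmod (\<Sum>i<dB. cnj (v i) * C $$ (a * dB + i, l)))\<^sup>2))"
    unfolding quad_form_gram[OF D] by (simp add: D_def)
  also have "\<dots> = of_real (\<Sum>l<e. \<Sum>a<dA. (cmod (\<Sum>i<dB. cnj (v i) * C $$ (a * dB + i, l)))\<^sup>2)"
    unfolding of_real_sum by (rule sum.swap)
  finally show ?thesis .
qed

lemma density_ptrace:
  assumes "density (dA * dB) \<psi>"
  shows "density dB (ptrace dA dB \<psi>)"
proof -
  obtain C where C: "C \<in> carrier_mat (dA * dB) (dA * dB)" "\<psi> = C * mat_adjoint C"
    using assms psd_factor unfolding density_def by metis
  have psd: "psd dB (ptrace dA dB \<psi>)"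
    unfolding C(2) psd_iff_quad_form quad_form_ptrace_gram[OF C(1)]
    by (auto simp: less_eq_complex_def intro!: sum_nonneg)
  have "mtrace (ptrace dA dB \<psi>) = (\<Sum>i<dB. \<Sum>a<dA. \<psi> $$ (a * dB + i, a * dB + i))"
    by (simp add: mtrace_def ptrace_def)
  also have "\<dots> = (\<Sum>a<dA. \<Sum>i<dB. \<psi> $$ (a * dB + i, a * dB + i))"
    by (rule sum.swap)
  also have "\<dots> = mtrace \<psi>"
    using density_carrier[OF assms] by (simp add: mtrace_def sum_lessThan_mult)
  finally show ?thesis using assms psd by (simp add: density_def)
qed

text \<open>The matrix is block diagonal with \<open>m\<close> copies of \<open>B\<close>.\<close>

lemma quad_form_kron_one:
  assumes B: "B \<in> carrier_mat n n"
  shows "quad_form (m * n) (kron (1\<^sub>m m) B) v = (\<Sum>i<m. quad_form n B (\<lambda>r. v (i * n + r)))"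
proof -
  have "quad_form (m * n) (kron (1\<^sub>m m) B) v
     = (\<Sum>i<m. \<Sum>r<n. \<Sum>j<m. \<Sum>s<n. cnj (v (i * n + r)) * kron (1\<^sub>m m) B $$ (i * n + r, j * n + s) * v (j * n + s))"
    by (simp add: quad_form_def sum_lessThan_mult)
  also have "\<dots> = (\<Sum>i<m. \<Sum>r<n. \<Sum>j<m. if j = i then
        (\<Sum>s<n. cnj (v (i * n + r)) * B $$ (r, s) * v (j * n + s)) else 0)"
    using B by (intro sum.cong refl) (auto simp: kron_block[OF one_carrier_mat B])
  also have "\<dots> = (\<Sum>i<m. quad_form n B (\<lambda>r. v (i * n + r)))"
    by (simp add: quad_form_def)
  finally show ?thesis .
qed

lemma apply_first_term_carrier:
  assumes "K \<in> carrier_mat m dA" "\<psi> \<in> carrier_mat (dA * dB) (dA * dB)"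
  shows "kron K (1\<^sub>m dB) * \<psi> * mat_adjoint (kron K (1\<^sub>m dB)) \<in> carrier_mat (m * dB) (m * dB)"
  using assms by (auto intro!: mult_carrier_mat simp del: kron_dim simp: kron_adjoint)

text \<open>Cyclicity of the trace moves each Kraus operator next to its adjoint, so the
  completeness relation in \<open>kraus\<close> will make the map trace preserving.\<close>

lemma mtrace_apply_first:
  assumes "\<forall>K\<in>set Ks. K \<in> carrier_mat m dA" and \<psi>: "\<psi> \<in> carrier_mat (dA * dB) (dA * dB)"
  shows "mtrace (apply_first m dB Ks \<psi>)
    = mtrace (kron (foldr (\<lambda>K S. mat_adjoint K * K + S) Ks (0\<^sub>m dA dA)) (1\<^sub>m dB) * \<psi>)"
  using assms(1)
proof (induction Ks)
  case Nil
  then show ?case using \<psi> by (simp add: apply_first_def)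
next
  case (Cons K Ks)
  have K: "K \<in> carrier_mat m dA" using Cons.prems by simp
  let ?f = "\<lambda>K. mat_adjoint K * K"
  let ?g = "\<lambda>K. kron K (1\<^sub>m dB) * \<psi> * mat_adjoint (kron K (1\<^sub>m dB))"
  let ?L = "kron K (1\<^sub>m dB)"
  have L: "?L \<in> carrier_mat (m * dB) (dA * dB)" using K by simp
  have fc: "?f K \<in> carrier_mat dA dA" using K by auto
  have F: "foldr (\<lambda>K S. ?f K + S) Ks (0\<^sub>m dA dA) \<in> carrier_mat dA dA"
    using Cons.prems by (intro foldr_add_carrier mult_carrier_mat[of _ dA m _ dA]) auto
  have G: "apply_first m dB Ks \<psi> \<in> carrier_mat (m * dB) (m * dB)"
    unfolding apply_first_def using Cons.prems by (intro foldr_add_carrier apply_first_term_carrier[OF _ \<psi>]) auto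
  have kf: "kron (?f K) (1\<^sub>m dB) \<in> carrier_mat (dA * dB) (dA * dB)" using fc by simp
  have kF: "kron (foldr (\<lambda>K S. ?f K + S) Ks (0\<^sub>m dA dA)) (1\<^sub>m dB) \<in> carrier_mat (dA * dB) (dA * dB)"
    using F by simp
  have IH: "mtrace (apply_first m dB Ks \<psi>) = mtrace (kron (foldr (\<lambda>K S. ?f K + S) Ks (0\<^sub>m dA dA)) (1\<^sub>m dB) * \<psi>)"
    using Cons by simp
  have "mtrace (apply_first m dB (K # Ks) \<psi>) = mtrace (?g K) + mtrace (apply_first m dB Ks \<psi>)"
    using apply_first_term_carrier[OF K \<psi>] G by (simp add: apply_first_def mtrace_add[of _ "m * dB"])
  also have "mtrace (?g K) = mtrace (mat_adjoint ?L * (?L * \<psi>))"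
    using L \<psi> by (intro mtrace_mult_commute[of _ "m * dB" "dA * dB"]) auto
  also have "mat_adjoint ?L * (?L * \<psi>) = (mat_adjoint ?L * ?L) * \<psi>"
    using L \<psi> by (auto simp: mult_assoc_dim)
  also have "mat_adjoint ?L * ?L = kron (?f K) (1\<^sub>m dB)"
    unfolding kron_adjoint using K by (subst kron_mult[of _ dA m _ dA _ dB dB _ dB]) auto
  also have "mtrace (kron (?f K) (1\<^sub>m dB) * \<psi>) + mtrace (apply_first m dB Ks \<psi>)
     = mtrace ((kron (?f K) (1\<^sub>m dB) + kron (foldr (\<lambda>K S. ?f K + S) Ks (0\<^sub>m dA dA)) (1\<^sub>m dB)) * \<psi>)"
    unfolding IH add_mult_distrib_mat[OF kf kF \<psi>]
    using mult_carrier_mat[OF kf \<psi>] mult_carrier_mat[OF kF \<psi>] by (rule mtrace_add[symmetric])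
  also have "kron (?f K) (1\<^sub>m dB) + kron (foldr (\<lambda>K S. ?f K + S) Ks (0\<^sub>m dA dA)) (1\<^sub>m dB)
     = kron (foldr (\<lambda>K S. ?f K + S) (K # Ks) (0\<^sub>m dA dA)) (1\<^sub>m dB)"
    using kron_add_left[OF fc F] by simp
  finally show ?case .
qed

lemma psd_foldr:
  "(\<And>K. K \<in> set Ks \<Longrightarrow> psd d (f K)) \<Longrightarrow> psd d (foldr (\<lambda>K S. f K + S) Ks (0\<^sub>m d d))"
proof (induction Ks)
  case Nil
  then show ?case by (simp add: psd_iff)
qed (auto intro: psd_add)

lemma density_apply_first:
  assumes K: "kraus m dA Ks" and \<psi>: "density (dA * dB) \<psi>"
  shows "density (m * dB) (apply_first m dB Ks \<psi>)"
proof -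
  have Ks: "\<forall>K\<in>set Ks. K \<in> carrier_mat m dA" using K by (simp add: kraus_def)
  have "psd (m * dB) (apply_first m dB Ks \<psi>)"
    unfolding apply_first_def using Ks \<psi>
    by (intro psd_foldr psd_congruence[of "dA * dB"]) (auto simp: density_def)
  moreover have "mtrace (apply_first m dB Ks \<psi>) = 1"
    using mtrace_apply_first[OF Ks density_carrier[OF \<psi>]] K \<psi> density_carrier[OF \<psi>]
    by (simp add: kraus_def kron_one density_def)
  ultimately show ?thesis by (simp add: density_def)
qed

text \<open>The message register costs a factor \<open>m\<close> twice: once for removing the coherences between its
  basis states, once for replacing its state by the maximally mixed one. Bob's marginal does not
  depend on Alice's channel.\<close>

lemma apply_first_dominated:
  assumes m: "m > 0" and K: "kraus m dA Ks" and \<psi>: "density (dA * dB) \<psi>"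
  shows "psd (m * dB) (of_real (real (m * m)) \<cdot>\<^sub>m kron (of_real (1 / real m) \<cdot>\<^sub>m 1\<^sub>m m) (ptrace dA dB \<psi>)
    - apply_first m dB Ks \<psi>)"
proof -
  obtain C where C: "C \<in> carrier_mat (dA * dB) (dA * dB)" "\<psi> = C * mat_adjoint C"
    using \<psi> psd_factor unfolding density_def by metis
  let ?e = "dA * dB"
  have Ks: "\<And>K. K \<in> set Ks \<Longrightarrow> K \<in> carrier_mat m dA" using K by (simp add: kraus_def)
  define T where "T = kron (1\<^sub>m m) (ptrace dA dB \<psi>)"
  have T: "T \<in> carrier_mat (m * dB) (m * dB)" unfolding T_def by (intro kron_carrier) auto
  have R: "apply_first m dB Ks \<psi> \<in> carrier_mat (m * dB) (m * dB)"
    using density_carrier[OF density_apply_first[OF K \<psi>]] .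
  \<comment> \<open>The maximally mixed state brings a factor \<open>1 / m\<close>, which cancels
    one of the two factors \<open>m\<close>.\<close>
  have eqT: "of_real (real (m * m)) \<cdot>\<^sub>m kron (of_real (1 / real m) \<cdot>\<^sub>m 1\<^sub>m m) (ptrace dA dB \<psi>) = of_real (real m) \<cdot>\<^sub>m T"
    unfolding T_def kron_smult_left using m by (intro eq_matI) auto
  have "0 \<le> quad_form (m * dB) (of_real (real m) \<cdot>\<^sub>m T - apply_first m dB Ks \<psi>) v" for v
  proof -
    \<comment> \<open>The component of \<open>v\<close> with message index \<open>i\<close> is
      paired with the rows of \<open>C\<close> with Alice's index \<open>a\<close>, in column
      \<open>l\<close>; Alice's operators then act on \<open>a\<close> alone.\<close>
    define g where "g i a l = (\<Sum>r<dB. cnj (v (i * dB + r)) * C $$ (a * dB + r, l))" for i a l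
    have qT: "quad_form (m * dB) T v = of_real (\<Sum>i<m. \<Sum>l<?e. \<Sum>a<dA. (cmod (g i a l))\<^sup>2)"
      unfolding T_def C(2) quad_form_kron_one[OF ptrace_carrier] quad_form_ptrace_gram[OF C(1)] g_def of_real_sum ..
    \<comment> \<open>The completeness relation in the form used here: the Kraus operators together
      preserve the squared norm of a vector.\<close>
    have kr: "(\<Sum>K\<leftarrow>Ks. \<Sum>i'<m. (cmod (\<Sum>a<dA. K $$ (i', a) * u a))\<^sup>2) = (\<Sum>a<dA. (cmod (u a))\<^sup>2)" for u
    proof -
      have "complex_of_real (\<Sum>a<dA. (cmod (u a))\<^sup>2) = (\<Sum>K\<leftarrow>Ks. quad_form dA (mat_adjoint K * K) u)"
        using quad_form_foldr[of Ks "\<lambda>K. mat_adjoint K * K" dA u] K Ks quad_form_one[of dA u]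
        by (fastforce simp: kraus_def)
      also have "\<dots> = (\<Sum>K\<leftarrow>Ks. complex_of_real (\<Sum>i'<m. (cmod (\<Sum>a<dA. K $$ (i', a) * u a))\<^sup>2))"
        using Ks by (intro arg_cong[of _ _ sum_list] map_cong refl quad_form_gram')
      also have "\<dots> = complex_of_real (\<Sum>K\<leftarrow>Ks. \<Sum>i'<m. (cmod (\<Sum>a<dA. K $$ (i', a) * u a))\<^sup>2)"
        by (induction Ks) simp_all
      finally show ?thesis by (simp only: of_real_eq_iff)
    qed
    have kraus_term: "quad_form (m * dB) (kron K (1\<^sub>m dB) * \<psi> * mat_adjoint (kron K (1\<^sub>m dB))) v
        = of_real (\<Sum>l<?e. (cmod (\<Sum>i<m. \<Sum>a<dA. K $$ (i, a) * g i a l))\<^sup>2)" if "K \<in> set Ks" for K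
    proof -
      let ?L = "kron K (1\<^sub>m dB)"
      have Kc: "K \<in> carrier_mat m dA" using Ks that .
      have L: "?L \<in> carrier_mat (m * dB) ?e" using Kc by simp
      have LC: "?L * C \<in> carrier_mat (m * dB) ?e" using L C by auto
      have "?L * \<psi> * mat_adjoint ?L = (?L * C) * mat_adjoint (?L * C)"
        unfolding C(2) adjoint_mult[OF L C(1)] using Kc C(1) by (auto simp: mult_assoc_dim)
      then have "quad_form (m * dB) (?L * \<psi> * mat_adjoint ?L) v
          = of_real (\<Sum>l<?e. (cmod (\<Sum>i<m * dB. cnj (v i) * (?L * C) $$ (i, l)))\<^sup>2)"
        using quad_form_gram[OF LC] by simp
      moreover have "(\<Sum>i<m * dB. cnj (v i) * (?L * C) $$ (i, l)) = (\<Sum>i<m. \<Sum>a<dA. K $$ (i, a) * g i a l)"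
        if l: "l < ?e" for l
      proof -
        have LCe: "(?L * C) $$ (i * dB + r, l) = (\<Sum>a<dA. K $$ (i, a) * C $$ (a * dB + r, l))"
          if "i < m" "r < dB" for i r
        proof -
          have "(?L * C) $$ (i * dB + r, l) = (\<Sum>a<dA. \<Sum>s<dB. ?L $$ (i * dB + r, a * dB + s) * C $$ (a * dB + s, l))"
            using Kc C(1) l mult_add_less[OF that] by (subst mult_index_sum) (auto simp: sum_lessThan_mult)
          also have "\<dots> = (\<Sum>a<dA. \<Sum>s<dB. if s = r then K $$ (i, a) * C $$ (a * dB + s, l) else 0)"
            using Kc that by (intro sum.cong refl) (auto simp: kron_block[OF Kc one_carrier_mat])
          finally show ?thesis using that by simp
        qed
        have "(\<Sum>i<m * dB. cnj (v i) * (?L * C) $$ (i, l))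
           = (\<Sum>i<m. \<Sum>r<dB. \<Sum>a<dA. K $$ (i, a) * (cnj (v (i * dB + r)) * C $$ (a * dB + r, l)))"
          unfolding sum_lessThan_mult by (intro sum.cong refl) (simp add: LCe sum_distrib_left mult_ac del: index_mult_mat(1))
        also have "\<dots> = (\<Sum>i<m. \<Sum>a<dA. \<Sum>r<dB. K $$ (i, a) * (cnj (v (i * dB + r)) * C $$ (a * dB + r, l)))"
          by (intro sum.cong refl sum.swap)
        finally show ?thesis by (simp add: g_def sum_distrib_left)
      qed
      ultimately show ?thesis by simp
    qed
    have "quad_form (m * dB) (apply_first m dB Ks \<psi>) v
        = (\<Sum>K\<leftarrow>Ks. quad_form (m * dB) (kron K (1\<^sub>m dB) * \<psi> * mat_adjoint (kron K (1\<^sub>m dB))) v)"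
      unfolding apply_first_def
      by (intro quad_form_foldr apply_first_term_carrier[OF Ks density_carrier[OF \<psi>]])
    also have "\<dots> = (\<Sum>K\<leftarrow>Ks. complex_of_real (\<Sum>l<?e. (cmod (\<Sum>i<m. \<Sum>a<dA. K $$ (i, a) * g i a l))\<^sup>2))"
      by (intro arg_cong[of _ _ sum_list] map_cong refl kraus_term)
    also have "\<dots> = complex_of_real (\<Sum>K\<leftarrow>Ks. \<Sum>l<?e. (cmod (\<Sum>i<m. \<Sum>a<dA. K $$ (i, a) * g i a l))\<^sup>2)"
      by (induction Ks) simp_all
    finally have qR: "quad_form (m * dB) (apply_first m dB Ks \<psi>) v = \<dots>" .
    have "(\<Sum>K\<leftarrow>Ks. \<Sum>l<?e. (cmod (\<Sum>i<m. \<Sum>a<dA. K $$ (i, a) * g i a l))\<^sup>2)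
        \<le> (\<Sum>K\<leftarrow>Ks. real m * (\<Sum>i<m. \<Sum>l<?e. \<Sum>i'<m. (cmod (\<Sum>a<dA. K $$ (i', a) * g i a l))\<^sup>2))"
    proof (rule sum_list_mono)
      fix K
      have "(\<Sum>l<?e. (cmod (\<Sum>i<m. \<Sum>a<dA. K $$ (i, a) * g i a l))\<^sup>2)
          \<le> (\<Sum>l<?e. real m * (\<Sum>i<m. \<Sum>i'<m. (cmod (\<Sum>a<dA. K $$ (i', a) * g i a l))\<^sup>2))"
      proof (rule sum_mono)
        fix l
        \<comment> \<open>Cauchy-Schwarz over the \<open>m\<close> message basis states removes the
          coherences at the price of a factor \<open>m\<close>.\<close>
        have "(cmod (\<Sum>i<m. \<Sum>a<dA. K $$ (i, a) * g i a l))\<^sup>2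
            \<le> real m * (\<Sum>i<m. (cmod (\<Sum>a<dA. K $$ (i, a) * g i a l))\<^sup>2)"
          using complex_Cauchy_Schwarz[of "\<lambda>_. 1" "\<lambda>i. \<Sum>a<dA. K $$ (i, a) * g i a l" "{..<m}"] by simp
        \<comment> \<open>Enlarging row \<open>i\<close> to all rows amounts to replacing the
          message state by the identity; \<open>kr\<close> evaluates only the full sum over
          rows.\<close>
        also have "\<dots> \<le> real m * (\<Sum>i<m. \<Sum>i'<m. (cmod (\<Sum>a<dA. K $$ (i', a) * g i a l))\<^sup>2)"
        proof (intro mult_left_mono sum_mono)
          fix i assume "i \<in> {..<m}"
          then show "(cmod (\<Sum>a<dA. K $$ (i, a) * g i a l))\<^sup>2 \<le> (\<Sum>i'<m. (cmod (\<Sum>a<dA. K $$ (i', a) * g i a l))\<^sup>2)"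
            by (intro member_le_sum[where f = "\<lambda>i'. (cmod (\<Sum>a<dA. K $$ (i', a) * g i a l))\<^sup>2"]) auto
        qed simp
        finally show "(cmod (\<Sum>i<m. \<Sum>a<dA. K $$ (i, a) * g i a l))\<^sup>2 \<le> \<dots>" .
      qed
      also have "\<dots> = real m * (\<Sum>i<m. \<Sum>l<?e. \<Sum>i'<m. (cmod (\<Sum>a<dA. K $$ (i', a) * g i a l))\<^sup>2)"
        unfolding sum_distrib_left[symmetric] by (subst sum.swap) simp
      finally show "(\<Sum>l<?e. (cmod (\<Sum>i<m. \<Sum>a<dA. K $$ (i, a) * g i a l))\<^sup>2) \<le> \<dots>" .
    qed
    also have "\<dots> = real m * (\<Sum>i<m. \<Sum>l<?e. \<Sum>K\<leftarrow>Ks. \<Sum>i'<m. (cmod (\<Sum>a<dA. K $$ (i', a) * g i a l))\<^sup>2)"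
      by (induction Ks) (simp_all add: sum.distrib distrib_left)
    also have "\<dots> = real m * (\<Sum>i<m. \<Sum>l<?e. \<Sum>a<dA. (cmod (g i a l))\<^sup>2)"
      unfolding kr ..
    finally have "(\<Sum>K\<leftarrow>Ks. \<Sum>l<?e. (cmod (\<Sum>i<m. \<Sum>a<dA. K $$ (i, a) * g i a l))\<^sup>2)
        \<le> real m * (\<Sum>i<m. \<Sum>l<?e. \<Sum>a<dA. (cmod (g i a l))\<^sup>2)" .
    then have "0 \<le> complex_of_real (real m * (\<Sum>i<m. \<Sum>l<?e. \<Sum>a<dA. (cmod (g i a l))\<^sup>2)
        - (\<Sum>K\<leftarrow>Ks. \<Sum>l<?e. (cmod (\<Sum>i<m. \<Sum>a<dA. K $$ (i, a) * g i a l))\<^sup>2))"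
      by (simp only: less_eq_complex_def) simp
    also have "\<dots> = quad_form (m * dB) (of_real (real m) \<cdot>\<^sub>m T - apply_first m dB Ks \<psi>) v"
      using T R by (subst quad_form_minus) (auto simp: quad_form_smult qT qR simp del: of_real_sum)
    finally show ?thesis .
  qed
  then show ?thesis
    unfolding eqT psd_iff_quad_form using R by (auto intro: minus_carrier_mat)
qed

section \<open>From the composed function to random access codes\<close>

lemma IP_Cons: "IP (a # u) (c # w) = ((a \<and> c) \<noteq> IP u w)"
  by (auto simp: IP_def)

lemma IP_replicate_False: "\<not> IP u (replicate c False)"
proof (induction u arbitrary: c)
  case (Cons a u)
  then show ?case by (cases c) (auto simp: IP_Cons, simp add: IP_def)
qed (simp add: IP_def)

lemma IP_unit: "j < length u \<Longrightarrow> IP u ((replicate (length u) False)[j := True]) = u ! j"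
proof (induction u arbitrary: j)
  case (Cons a u)
  then show ?case by (cases j) (auto simp: IP_Cons IP_replicate_False)
qed simp

text \<open>The leading 1 lets Bob set the inner product of a block to any value by his own first
  bit. It uses up one bit per block, hence the \<open>b - 1\<close> in the bound.\<close>

definition encode :: "nat \<Rightarrow> nat \<Rightarrow> bool list \<Rightarrow> bool list list" where
  "encode n c z = map (\<lambda>i. True # take c (drop (i * c) z)) [0..<n]"

text \<open>Against an encoded input, block \<open>i\<close> ignores the leading 1 and reads bit
  \<open>j\<close> of the chunk; every other block yields the constant
  \<open>s ! i'\<close>.\<close>

definition query :: "nat \<Rightarrow> nat \<Rightarrow> bool list \<Rightarrow> nat \<Rightarrow> nat \<Rightarrow> bool list list" where
  "query n c s i j = map (\<lambda>i'. if i' = i then False # (replicate c False)[j := True]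
     else s ! i' # replicate c False) [0..<n]"

lemma length_chunk:
  assumes "length z = n * c" "i < n"
  shows "length (take c (drop (i * c) z)) = c"
proof -
  have "Suc i * c \<le> n * c" using assms by (intro mult_le_mono1) simp
  then show ?thesis using assms by simp
qed

lemma encode_block_inputs: "length z = n * c \<Longrightarrow> encode n c z \<in> block_inputs n (Suc c)"
  using length_chunk[of z n c] by (auto simp: encode_def block_inputs_def)

lemma query_block_inputs: "query n c s i j \<in> block_inputs n (Suc c)"
  by (auto simp: query_def block_inputs_def)

lemma encode_query:
  assumes z: "length z = n * c" and "i < n" "j < c" and s: "length s = n"
  shows "map2 IP (encode n c z) (query n c s i j) = s[i := z ! (i * c + j)]"
proof (rule nth_equalityI)
  fix i' assume "i' < length (map2 IP (encode n c z) (query n c s i j))"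
  then have i': "i' < n" by (simp add: encode_def query_def)
  have le: "i * c \<le> n * c" using \<open>i < n\<close> by simp
  have "IP (take c (drop (i * c) z)) ((replicate c False)[j := True]) = z ! (i * c + j)"
    using IP_unit[of j "take c (drop (i * c) z)"] length_chunk[OF z \<open>i < n\<close>] \<open>j < c\<close> z
      mult_add_less[OF \<open>i < n\<close> \<open>j < c\<close>] le
    by simp
  then show "map2 IP (encode n c z) (query n c s i j) ! i' = s[i := z ! (i * c + j)] ! i'"
    using i' s by (auto simp: encode_def query_def IP_Cons IP_replicate_False nth_list_update)
qed (use s in \<open>simp add: encode_def query_def\<close>)

lemma prob_outcome_branch:
  assumes "P \<in> carrier_mat d d"
  shows "prob_outcome d (branch d P g) \<rho> c = prob_outcome d P \<rho> (c = g)"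
proof -
  have "1\<^sub>m d - (1\<^sub>m d - P) = P" using assms by (intro eq_matI) auto
  then show ?thesis by (auto simp: prob_outcome_def)
qed

text \<open>At an assignment that is sensitive at \<open>i\<close>, the dependence of
  \<open>f\<close> on coordinate \<open>i\<close> alone is the identity or the negation, so
  \<open>query\<close> turns the protocol into a decoder for every single message bit. Bit
  \<open>k\<close> sits in block \<open>k div c\<close> at offset \<open>k mod c\<close>.\<close>

lemma composed_IP_bound:
  assumes dep: "depends_on_all n f" and P: "\<And>y. y \<in> block_inputs n (Suc c) \<Longrightarrow> projector d (P y)"
    and \<tau>: "density d \<tau>" and l: "0 < (l :: real)"
    and \<sigma>: "\<And>x. x \<in> block_inputs n (Suc c) \<Longrightarrow> density d (\<sigma> x) \<and> psd d (of_real l \<cdot>\<^sub>m \<tau> - \<sigma> x)"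
    and correct: "\<And>x y. x \<in> block_inputs n (Suc c) \<Longrightarrow> y \<in> block_inputs n (Suc c) \<Longrightarrow>
      1 - \<epsilon> \<le> prob_outcome d (P y) (\<sigma> x) (compose_IP f x y)"
    and \<epsilon>: "0 < \<epsilon>" "\<epsilon> < 1/2"
  shows "(1 - Hbin \<epsilon>) * real (n * c) \<le> log 2 l"
proof -
  obtain s where s: "\<And>i. i < n \<Longrightarrow> length (s i) = n \<and> f (s i) \<noteq> f ((s i)[i := \<not> s i ! i])"
    using dep unfolding depends_on_all_def by metis
  \<comment> \<open>\<open>g i\<close> is true if the restriction is the identity and false if it is
    the negation; in the latter case \<open>Ps\<close> takes the complementary projector to flip the
    outcome.\<close>
  define g where "g i = f ((s i)[i := True])" for i
  have "f ((s i)[i := True]) \<noteq> f ((s i)[i := False])" if "i < n" for i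
    using s[OF that] by (metis (full_types) list_update_id)
  then have fs: "f ((s i)[i := u]) = (u = g i)" if "i < n" for i u
    using that by (cases u) (auto simp: g_def)
  define y where "y k = query n c (s (k div c)) (k div c) (k mod c)" for k
  define Ps where "Ps = map (\<lambda>k. branch d (P (y k)) (g (k div c))) [0..<n * c]"
  have y: "y k \<in> block_inputs n (Suc c)" for k
    unfolding y_def by (rule query_block_inputs)
  show ?thesis
  proof (rule random_access_bound[where Ps = Ps and \<rho> = "\<lambda>z. \<sigma> (encode n c z)", OF _ _ \<tau> l _ _ \<epsilon>])
    show "\<forall>P\<in>set Ps. projector d P"
      unfolding Ps_def set_map using projector_branch[OF P[OF y]] by blast
    show "density d (\<sigma> (encode n c z)) \<and> psd d (of_real l \<cdot>\<^sub>m \<tau> - \<sigma> (encode n c z))" if "length z = n * c" for z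
      using that by (intro \<sigma> encode_block_inputs)
    show "1 - \<epsilon> \<le> prob_outcome d (Ps ! k) (\<sigma> (encode n c z)) (z ! k)" if z: "length z = n * c" and k: "k < n * c" for z k
    proof -
      note kc = div_mod_less[OF k]
      have "compose_IP f (encode n c z) (y k) = (z ! k = g (k div c))"
        unfolding compose_IP_def y_def using encode_query[OF z kc, of "s (k div c)"] s[OF kc(1)] fs[OF kc(1)]
        by simp
      then show ?thesis
        using correct[OF encode_block_inputs[OF z] y[of k]] k projector_carrier[OF P[OF y[of k]]]
        by (simp add: Ps_def prob_outcome_branch del: if_split)
    qed
  qed (simp add: Ps_def)
qed

lemma oneway_protocol_bound:
  assumes dep: "depends_on_all n f" and \<epsilon>: "0 < \<epsilon>" "\<epsilon> < 1/2"
    and prot: "oneway_protocol (block_inputs n (Suc c)) (block_inputs n (Suc c)) (compose_IP f) \<epsilon> q"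
  shows "(1 - Hbin \<epsilon>) * real (n * c) \<le> real q"
proof -
  let ?X = "block_inputs n (Suc c)" and ?d = "2 ^ q :: nat"
  obtain \<rho> P where \<rho>: "\<And>x. x \<in> ?X \<Longrightarrow> density ?d (\<rho> x)" and P: "\<And>y. y \<in> ?X \<Longrightarrow> projector ?d (P y)"
    and correct: "\<And>x y. x \<in> ?X \<Longrightarrow> y \<in> ?X \<Longrightarrow> 1 - \<epsilon> \<le> prob_outcome ?d (P y) (\<rho> x) (compose_IP f x y)"
    using prot unfolding oneway_protocol_def by blast
  have "complex_of_real (2 ^ q) \<cdot>\<^sub>m (of_real (1 / real ?d) \<cdot>\<^sub>m 1\<^sub>m ?d) = 1\<^sub>m ?d"
    by (intro eq_matI) auto
  then have "(1 - Hbin \<epsilon>) * real (n * c) \<le> log 2 (2 ^ q)"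
    using \<rho> density_le_one
    by (intro composed_IP_bound[OF dep P density_maximally_mixed _ _ correct \<epsilon>]) auto
  then show ?thesis by (simp add: log_nat_power)
qed

lemma oneway_protocol_ent_bound:
  assumes dep: "depends_on_all n f" and \<epsilon>: "0 < \<epsilon>" "\<epsilon> < 1/2"
    and prot: "oneway_protocol_ent (block_inputs n (Suc c)) (block_inputs n (Suc c)) (compose_IP f) \<epsilon> q"
  shows "(1 - Hbin \<epsilon>) * real (n * c) \<le> 2 * real q"
proof -
  let ?X = "block_inputs n (Suc c)" and ?m = "2 ^ q :: nat"
  obtain dA dB \<psi> K P where \<psi>: "density (dA * dB) \<psi>" and K: "\<And>x. x \<in> ?X \<Longrightarrow> kraus ?m dA (K x)"
    and P: "\<And>y. y \<in> ?X \<Longrightarrow> projector (?m * dB) (P y)"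
    and correct: "\<And>x y. x \<in> ?X \<Longrightarrow> y \<in> ?X \<Longrightarrow>
      1 - \<epsilon> \<le> prob_outcome (?m * dB) (P y) (apply_first ?m dB (K x) \<psi>) (compose_IP f x y)"
    using prot unfolding oneway_protocol_ent_def by blast
  \<comment> \<open>All of Bob's states are dominated by the maximally mixed message tensored with
    his reduced state, with factor \<open>4 ^ q\<close>.\<close>
  have "(1 - Hbin \<epsilon>) * real (n * c) \<le> log 2 (real (?m * ?m))"
    by (intro composed_IP_bound[OF dep P density_kron[OF density_maximally_mixed density_ptrace[OF \<psi>]] _ _ correct \<epsilon>]
        conjI density_apply_first[OF K \<psi>] apply_first_dominated[OF _ K \<psi>]) auto
  also have "log 2 (real (?m * ?m)) = 2 * real q"
    by (simp add: log_nat_power log_mult)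
  finally show ?thesis .
qed

section \<open>Existence of protocols\<close>

lemma finite_block_inputs: "finite (block_inputs n b)"
  and card_block_inputs: "card (block_inputs n b) = 2 ^ (n * b)"
proof -
  have eq: "block_inputs n b = {xs. set xs \<subseteq> words b \<and> length xs = n}"
    by (auto simp: block_inputs_def)
  have fin: "finite (words b)" using finite_lists_length_eq[of "UNIV :: bool set" b] by simp
  have "card (words b) = 2 ^ b" using card_lists_length_eq[of "UNIV :: bool set" b] by simp
  then show "finite (block_inputs n b)" "card (block_inputs n b) = 2 ^ (n * b)"
    unfolding eq using finite_lists_length_eq[OF fin, of n] card_lists_length_eq[OF fin, of n]
    by (simp_all add: mult.commute flip: power_mult)
qed

text \<open>A one-column matrix serves both as the factor of a basis state and as the Kraus operator
  that prepares it from a one-dimensional register.\<close>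

definition basis_col :: "nat \<Rightarrow> nat \<Rightarrow> complex mat" where
  "basis_col d k = mat d 1 (\<lambda>(i, j). if i = k then 1 else 0)"

lemma basis_col_carrier: "basis_col d k \<in> carrier_mat d 1"
  by (simp add: basis_col_def)

lemmas [simp] = basis_col_carrier basis_col_carrier[simplified]

lemma basis_col_normalized:
  "k < d \<Longrightarrow> mat_adjoint (basis_col d k) * basis_col d k = 1\<^sub>m 1"
  by (intro eq_matI) (auto simp: basis_col_def mult_index_sum if_distrib[of cnj] if_distrib[of "\<lambda>z. _ * z"]
      simp del: index_mult_mat(1) cong: if_cong)

lemma density_basis:
  assumes "k < d"
  shows "density d (basis_col d k * mat_adjoint (basis_col d k))"
proof -
  have "mtrace (basis_col d k * mat_adjoint (basis_col d k)) = mtrace (mat_adjoint (basis_col d k) * basis_col d k)"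
    by (intro mtrace_mult_commute[of _ d 1]) auto
  then show ?thesis
    using assms psd_mult_adjoint[of "basis_col d k" d 1] by (simp add: density_def basis_col_normalized)
qed

lemma projector_diagonal:
  "projector d (mat d d (\<lambda>(i, j). if i = j \<and> S i then 1 else 0))"
  unfolding projector_def
proof (intro conjI)
  let ?P = "mat d d (\<lambda>(i, j). if i = j \<and> S i then 1 else 0) :: complex mat"
  show "?P * ?P = ?P"
  proof (rule eq_matI)
    fix i j assume "i < dim_row ?P" "j < dim_col ?P"
    then have ij: "i < d" "j < d" by auto
    have "(?P * ?P) $$ (i, j) = (\<Sum>l<d. ?P $$ (i, l) * ?P $$ (l, j))"
      using ij by (subst mult_index_sum) auto
    also have "\<dots> = (\<Sum>l<d. if l = i then (if i = j \<and> S i then 1 else 0) else 0)"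
      using ij by (intro sum.cong refl) auto
    finally show "(?P * ?P) $$ (i, j) = ?P $$ (i, j)" using ij by simp
  qed auto
qed (auto intro!: eq_matI)

lemma prob_outcome_basis:
  assumes "k < d"
  shows "prob_outcome d (mat d d (\<lambda>(i, j). if i = j \<and> S i then 1 else 0))
    (basis_col d k * mat_adjoint (basis_col d k)) (S k) = 1"
proof -
  let ?P = "mat d d (\<lambda>(i, j). if i = j \<and> S i then 1 else 0) :: complex mat"
  let ?B = "branch d ?P (S k)" and ?e = "basis_col d k"
  have B: "?B \<in> carrier_mat d d" by auto
  have "?B * ?e = ?e"
  proof (rule eq_matI)
    fix i j assume "i < dim_row ?e" "j < dim_col ?e"
    then have i: "i < d" "j = 0" by (auto simp: basis_col_def)
    have "(?B * ?e) $$ (i, j) = (\<Sum>l<d. ?B $$ (i, l) * ?e $$ (l, j))"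
      using i by (subst mult_index_sum) (auto simp: basis_col_def)
    also have "\<dots> = (\<Sum>l<d. if l = k then ?B $$ (i, k) else 0)"
      using i by (intro sum.cong refl) (simp add: basis_col_def del: if_split)
    also have "\<dots> = ?e $$ (i, j)" using i assms by (auto simp: basis_col_def)
    finally show "(?B * ?e) $$ (i, j) = ?e $$ (i, j)" .
  qed (auto simp: basis_col_def)
  then have "?B * (?e * mat_adjoint ?e) = ?e * mat_adjoint ?e"
    using B by (simp flip: assoc_mult_mat[OF B basis_col_carrier adjoint_carrier[OF basis_col_carrier]])
  then show ?thesis
    using density_basis[OF assms] unfolding prob_outcome_def density_def by (simp only:) simp
qed

text \<open>\<open>Q_oneway\<close> and \<open>Q_oneway_ent\<close> are \<open>LEAST\<close> values,
  which say something about protocols only if some cost is achievable. Alice sends her whole input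
  as a basis state; the version with entanglement shares the trivial state of dimension 1.\<close>

lemma oneway_protocol_exists:
  assumes "finite X" "card X = 2 ^ q" "0 \<le> \<epsilon>"
  shows "oneway_protocol X Y F \<epsilon> q"
    and "oneway_protocol_ent X Y F \<epsilon> q"
proof -
  let ?d = "2 ^ q :: nat"
  obtain h where h: "bij_betw h X {0..<?d}"
    using ex_bij_betw_finite_nat[OF assms(1)] assms(2) by auto
  \<comment> \<open>Bob recovers Alice's input from the basis index and evaluates
    \<open>F\<close>.\<close>
  define S where "S y i = F (inv_into X h i) y" for y i
  define \<rho> where "\<rho> x = basis_col ?d (h x) * mat_adjoint (basis_col ?d (h x))" for x
  define P where "P y = (mat ?d ?d (\<lambda>(i, j). if i = j \<and> S y i then 1 else 0) :: complex mat)" for y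
  have hx: "h x < ?d" if "x \<in> X" for x using h that by (auto simp: bij_betw_def)
  have S: "S y (h x) = F x y" if "x \<in> X" for x y
    using h that by (simp add: S_def bij_betw_def)
  have proj: "projector ?d (P y)" for y unfolding P_def by (rule projector_diagonal)
  have prob: "1 - \<epsilon> \<le> prob_outcome ?d (P y) (\<rho> x) (F x y)" if "x \<in> X" for x y
    using prob_outcome_basis[OF hx[OF that], of "S y"] assms(3) S[OF that] by (simp add: P_def \<rho>_def)
  show "oneway_protocol X Y F \<epsilon> q"
    unfolding oneway_protocol_def using proj prob density_basis[OF hx]
    by (intro exI[of _ \<rho>] exI[of _ P]) (auto simp: \<rho>_def)
  have kron1: "kron A (1\<^sub>m 1) = A" for A
    by (rule eq_matI) (auto simp: kron_index)
  have app: "apply_first ?d 1 [basis_col ?d (h x)] (1\<^sub>m 1) = \<rho> x" for x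
  proof -
    have "basis_col ?d (h x) * 1\<^sub>m 1 = basis_col ?d (h x)"
      by (rule right_mult_one_mat[OF basis_col_carrier])
    moreover have "\<rho> x + 0\<^sub>m ?d ?d = \<rho> x"
      unfolding \<rho>_def by (intro right_add_zero_mat mult_carrier_mat[of _ ?d 1 _ ?d]) auto
    ultimately show ?thesis unfolding apply_first_def kron1 foldr.simps o_def by (simp add: \<rho>_def)
  qed
  have one: "density (1 * 1) (1\<^sub>m 1)"
    using psd_one[of 1] by (simp add: density_def)
  have kr: "kraus ?d 1 [basis_col ?d (h x)]" if "x \<in> X" for x
    using basis_col_normalized[OF hx[OF that]] by (simp add: kraus_def)
  show "oneway_protocol_ent X Y F \<epsilon> q"
    unfolding oneway_protocol_ent_def
    by (rule exI[of _ 1], rule exI[of _ 1], rule exI[of _ "1\<^sub>m 1"], rule exI[of _ "\<lambda>x. [basis_col ?d (h x)]"], rule exI[of _ P])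
      (use one kr proj prob in \<open>auto simp only: app mult_1_right zero_less_one\<close>)
qed

section \<open>The lower bounds\<close>

theorem theorem1p1:
  fixes n b :: nat and f :: "bool list \<Rightarrow> bool" and \<epsilon> :: real
  assumes "n \<ge> 1" and "b \<ge> 1"
    and "depends_on_all n f"
    and "0 < \<epsilon>" and "\<epsilon> < 1/2"
  shows "real (Q_oneway (block_inputs n b) (block_inputs n b) (compose_IP f) \<epsilon>)
           \<ge> (1 - Hbin \<epsilon>) * real n * (real b - 1)
         \<and> real (Q_oneway_ent (block_inputs n b) (block_inputs n b) (compose_IP f) \<epsilon>)
           \<ge> (1 - Hbin \<epsilon>) * real n * (real b - 1) / 2"
proof -
  \<comment> \<open>\<open>c\<close> is the number \<open>b - 1\<close> of message bits per
    block.\<close>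
  obtain c where b: "b = Suc c" using assms(2) by (cases b) auto
  let ?X = "block_inputs n (Suc c)"
  note ex = oneway_protocol_exists[OF finite_block_inputs card_block_inputs less_imp_le[OF assms(4)],
      of n "Suc c" ?X "compose_IP f"]
  have "(1 - Hbin \<epsilon>) * real (n * c) \<le> real (Q_oneway ?X ?X (compose_IP f) \<epsilon>)"
    unfolding Q_oneway_def using ex(1) by (intro oneway_protocol_bound[OF assms(3-5)] LeastI)
  moreover have "(1 - Hbin \<epsilon>) * real (n * c) \<le> 2 * real (Q_oneway_ent ?X ?X (compose_IP f) \<epsilon>)"
    unfolding Q_oneway_ent_def using ex(2) by (intro oneway_protocol_ent_bound[OF assms(3-5)] LeastI)
  ultimately show ?thesis by (simp add: b mult.assoc)
qed

end
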